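(* Let $p$ be an odd prime, let $G$ be an $\mathcal{M}_1$ $p$-group, and let $i$ be a positive integer. Then $\exp \Omega_i(G)\leq p^i$.
   Context: For a finite $p$-group $G$ and $k\ge 0$, $\mho_k(G)=\langle g^{p^k} \mid g\in G\rangle$ and $\Omega_k(G)=\langle g\in G \mid g^{p^k}=1\rangle$. For $p$ odd, a finite $p$-group $G$ is powerful if $[G,G]\leq \mho_1(G)$. An $\mathcal{M}_1$ $p$-group is a finite $p$-group all of whose maximal subgroups (i.e. subgroups of index $p$) are powerful. $\exp$ denotes the exponent of a group. *)

theory Defs
  imports "HOL-Algebra.Algebra"
begin

definition finite_p_group :: "nat \<Rightarrow> ('a, 'b) monoid_scheme \<Rightarrow> bool" where
  "finite_p_group p G \<longleftrightarrow>
     Factorial_Ring.prime p \<and> group G \<and> finite (carrier G) \<and> (\<exists>n. order G = p ^ n)"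

definition agemo :: "nat \<Rightarrow> nat \<Rightarrow> ('a, 'b) monoid_scheme \<Rightarrow> 'a set" where
  "agemo p k G = generate G {g [^]\<^bsub>G\<^esub> (p ^ k) | g. g \<in> carrier G}"

definition Omega :: "nat \<Rightarrow> nat \<Rightarrow> ('a, 'b) monoid_scheme \<Rightarrow> 'a set" where
  "Omega p k G = generate G {g \<in> carrier G. g [^]\<^bsub>G\<^esub> (p ^ k) = \<one>\<^bsub>G\<^esub>}"

text \<open>This is the notion of powerful group for odd p only; for p = 2 the usual
  definition uses fourth powers instead.\<close>

definition powerful :: "nat \<Rightarrow> ('a, 'b) monoid_scheme \<Rightarrow> bool" where
  "powerful p G \<longleftrightarrow> finite_p_group p G \<and> derived G (carrier G) \<subseteq> agemo p 1 G"

text \<open>The maximal subgroups of a finite p-group are exactly its subgroups of index p.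
  The trivial group has none, so it satisfies the condition vacuously.\<close>

definition M1_p_group :: "nat \<Rightarrow> ('a, 'b) monoid_scheme \<Rightarrow> bool" where
  "M1_p_group p G \<longleftrightarrow>
     finite_p_group p G \<and>
     (\<forall>M. subgroup M G \<and> card (rcosets\<^bsub>G\<^esub> M) = p \<longrightarrow> powerful p (G\<lparr>carrier := M\<rparr>))"

text \<open>Meaningful only if some positive power annihilates the group, as is the case
  for every finite group.\<close>

definition group_exponent :: "('a, 'b) monoid_scheme \<Rightarrow> nat" where
  "group_exponent G = (LEAST n. 0 < n \<and> (\<forall>x\<in>carrier G. x [^]\<^bsub>G\<^esub> n = \<one>\<^bsub>G\<^esub>))"

end

theory Submission
  imports Defs
begin

text \<open>Write \<open>P\<close> for the set of elements of order dividing \<open>p\<close>.  The theorem for \<open>i = 1\<close> says that \<open>P\<close>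
  is closed under products; the general case follows by passing to \<open>G/P\<close>, because the class of
  groups with powerful maximal subgroups is closed under quotients
  (\<open>omega_closed_lift\<close>, \<open>M1_p_group_image\<close>).

  Let \<open>x\<close> and \<open>y\<close> have order \<open>p\<close>.  If they generate a proper subgroup, they lie in a maximal
  subgroup, which is powerful, and the corresponding fact for powerful groups applies.  Otherwise,
  and if \<open>G\<close> is not abelian, take a maximal subgroup \<open>M\<close> containing \<open>x\<close>.  The elements of order dividing \<open>p\<close> in \<open>M\<close> form a normal subgroup \<open>N\<close>
  of \<open>G\<close> containing \<open>x\<close>, so \<open>G\<close> is the product of \<open>N\<close> and the powers of \<open>y\<close>; as \<open>y\<close> has order
  \<open>p\<close>, this forces \<open>N = M\<close>.  A powerful group of exponent \<open>p\<close> is abelian, so \<open>M\<close> is abelian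
  (\<open>maximal_subgroup_abelian\<close>), and likewise some maximal subgroup containing \<open>y\<close>.  The commutator
  of \<open>x\<close> and \<open>y\<close> lies in both, hence is central, and in a group of class two with \<open>p\<close> odd the
  product of two elements of order \<open>p\<close> has order dividing \<open>p\<close>.

  It remains to treat powerful \<open>G\<close>.  Let \<open>H\<close> be the subgroup generated by the \<open>p\<close>-th powers
  (\<open>agemo p 1 G\<close>) and \<open>K\<close> the one generated by the \<open>p\<close>-th powers of elements of \<open>H\<close>
  (\<open>agemo2 p G\<close>).  The classical facts needed are: \<open>[H, G] \<le> K\<close>; every element of \<open>H\<close> is a \<open>p\<close>-th
  power; and the subgroup generated by \<open>H\<close> and one element is powerful, and proper if
  \<open>G\<close> is not abelian.  The last point gives room for an induction on the order: for \<open>x\<close> of order dividing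
  \<open>p\<close> or \<open>p^2\<close>, all conjugates of \<open>x\<close>, hence also its commutators, lie in such a smaller powerful
  group.

  The induction carries one more property besides closure of \<open>P\<close> (\<open>absorbing\<close>): if \<open>e\<close> in \<open>H\<close> has
  order dividing \<open>p\<close> and \<open>v\<close> has order dividing \<open>p^2\<close>, then \<open>(e v)^p = v^p\<close>.  Its analogue one power of \<open>p\<close> higher
  (\<open>absorbing2\<close>) follows for \<open>G\<close> from the property itself in a quotient and in \<open>H\<close>, both of smaller order.
  Applied to \<open>x u x\<inverse> = [x, u] u\<close> it shows that \<open>x\<close> of order dividing \<open>p^2\<close> commutes with each element
  \<open>c = u^(p^2)\<close> of \<open>K\<close> of order dividing \<open>p\<close>; this makes \<open>e\<close> and \<open>v\<close> generate a group of class at most two and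
  so proves the property for \<open>G\<close>.  Applied in the same way with \<open>u^p\<close> in place of \<open>u^(p^2)\<close>, the
  property for \<open>G\<close> shows that \<open>P\<close> commutes elementwise with its intersection with \<open>H\<close>, in
  particular \<open>x\<close> and \<open>y\<close> with their commutator, and closure of \<open>P\<close> follows.\<close>

section \<open>Quotients\<close>

locale group_epi = group_hom G Q \<phi> for G (structure) and Q (structure) and \<phi> +
  assumes surj: "\<phi> ` carrier G = carrier Q"
begin

lemma lift_elem:
  assumes "q \<in> carrier Q"
  obtains g where "g \<in> carrier G" "\<phi> g = q"
  using assms surj by (metis imageE)

lemma mem_kernel_iff: "a \<in> carrier G \<Longrightarrow> a \<in> kernel G Q \<phi> \<longleftrightarrow> \<phi> a = \<one>\<^bsub>Q\<^esub>"
  by (simp add: kernel_def)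

lemma order_eq: "order G = order Q * card (kernel G Q \<phi>)"
proof -
  have "order Q = order (G Mod kernel G Q \<phi>)"
    using iso_same_order[OF FactGroup_iso_set[OF surj]] by simp
  then have "order Q = card (rcosets\<^bsub>G\<^esub> (kernel G Q \<phi>))"
    by (simp add: order_def FactGroup_def)
  then show ?thesis
    using G.lagrange[OF subgroup_kernel] by simp
qed

lemma finite_image: "finite (carrier G) \<Longrightarrow> finite (carrier Q)"
  using surj by (metis finite_imageI)

lemma preimage_subgroup:
  assumes "subgroup K Q"
  shows "subgroup {g \<in> carrier G. \<phi> g \<in> K} G"
  by (rule G.subgroupI)
     (use assms in \<open>auto simp: subgroup.m_inv_closed subgroup.m_closed subgroup.one_closed
        intro!: exI[of _ "\<one>"]\<close>)

lemma preimage_image: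
  assumes "subgroup K Q"
  shows "\<phi> ` {g \<in> carrier G. \<phi> g \<in> K} = K"
  using subgroup.subset[OF assms] surj by auto

text \<open>The epimorphism restricts to one from the preimage of \<open>K\<close> onto \<open>K\<close> with the same kernel, so both
  indices are obtained from Lagrange's theorem by cancelling the order of the kernel.\<close>

lemma card_rcosets_preimage:
  assumes "finite (carrier G)" "subgroup K Q"
  shows "card (rcosets\<^bsub>G\<^esub> {g \<in> carrier G. \<phi> g \<in> K}) = card (rcosets\<^bsub>Q\<^esub> K)"
proof -
  define M where "M = {g \<in> carrier G. \<phi> g \<in> K}"
  have M: "subgroup M G" "\<phi> ` M = K"
    using preimage_subgroup[OF assms(2)] preimage_image[OF assms(2)] by (simp_all add: M_def)
  interpret M: group_epi "G\<lparr>carrier := M\<rparr>" "Q\<lparr>carrier := K\<rparr>" \<phi>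
    using induced_group_hom[OF M(1)] M(2) by (simp add: group_epi_def group_epi_axioms_def)
  have "kernel (G\<lparr>carrier := M\<rparr>) (Q\<lparr>carrier := K\<rparr>) \<phi> = kernel G Q \<phi>"
    using subgroup.one_closed[OF assms(2)] by (auto simp: kernel_def M_def)
  then have M_eq: "card M = card K * card (kernel G Q \<phi>)"
    using M.order_eq by (simp add: order_def)
  have "card (rcosets\<^bsub>G\<^esub> M) * card M = card (rcosets\<^bsub>Q\<^esub> K) * card M"
    using G.lagrange[OF M(1)] H.lagrange[OF assms(2)] order_eq M_eq by (metis mult.assoc mult.commute)
  moreover have "card M > 0"
    using subgroup.finite_imp_card_positive[OF M(1) assms(1)] .
  ultimately show ?thesis
    by (simp add: M_def)
qed

lemma preimage_normal:
  assumes "K \<lhd> Q"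
  shows "{g \<in> carrier G. \<phi> g \<in> K} \<lhd> G"
  using assms preimage_subgroup unfolding G.normal_inv_iff H.normal_inv_iff by auto

end

text \<open>Quotient groups live on a type of sets, which an induction over groups of a fixed type cannot
  reach.  A finite quotient can be transported to the natural numbers, so that induction on
  the order works for groups of type \<open>nat monoid\<close>.\<close>

lemma (in group) quotient_on_nat:
  assumes "finite (carrier G)" "N \<lhd> G"
  obtains Q :: "nat monoid" and \<phi> where "group_epi G Q \<phi>" "kernel G Q \<phi> = N"
proof -
  interpret N: normal N G by fact
  define F where "F = G Mod N"
  interpret F: group F
    unfolding F_def by (rule N.factorgroup_is_group)
  have "finite (carrier F)"
    using assms(1) by (simp add: F_def carrier_FactGroup)
  then obtain f :: "'a set \<Rightarrow> nat" where f: "inj_on f (carrier F)"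
    using finite_imp_inj_to_nat_seg by blast
  \<comment> \<open>Only the product on the image of \<open>f\<close> matters; carrier and unit are put right in \<open>Q\<close>.\<close>
  define Q0 :: "nat monoid" where
    "Q0 = \<lparr>carrier = UNIV,
       monoid.mult = \<lambda>a b. f (inv_into (carrier F) f a \<otimes>\<^bsub>F\<^esub> inv_into (carrier F) f b), one = 0\<rparr>"
  have fh: "f \<in> hom F Q0"
    using f by (auto simp: hom_def Q0_def)
  define Q where "Q = Q0\<lparr>carrier := f ` carrier F, one := f \<one>\<^bsub>F\<^esub>\<rparr>"
  have Q: "group Q"
    unfolding Q_def by (rule F.hom_imp_img_group[OF fh])
  define \<phi> where "\<phi> = (\<lambda>a. f (N #> a))"
  have cF: "N #> a \<in> carrier F" if "a \<in> carrier G" for a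
    using that by (auto simp: F_def carrier_FactGroup)
  have hom: "\<phi> \<in> hom G Q"
    using fh cF N.r_coset_hom_Mod
    by (auto simp: hom_def Q_def \<phi>_def F_def[symmetric] Pi_iff)
  have im: "\<phi> ` carrier G = carrier Q"
    by (auto simp: Q_def \<phi>_def F_def carrier_FactGroup)
  have "\<phi> a = \<one>\<^bsub>Q\<^esub> \<longleftrightarrow> a \<in> N" if a: "a \<in> carrier G" for a
  proof -
    have "\<phi> a = \<one>\<^bsub>Q\<^esub> \<longleftrightarrow> N #> a = \<one>\<^bsub>F\<^esub>"
      using inj_on_eq_iff[OF f cF[OF a] F.one_closed] by (simp add: \<phi>_def Q_def)
    also have "\<dots> \<longleftrightarrow> a \<in> N"
      using a by (metis F_def coset_join1 coset_join2 one_FactGroup N.subgroup_axioms N.subset)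
    finally show ?thesis .
  qed
  then have "kernel G Q \<phi> = N"
    by (auto simp: kernel_def dest: N.mem_carrier)
  moreover have "group_epi G Q \<phi>"
    using Q hom im by (simp add: group_epi_def group_epi_axioms_def group_hom_def group_hom_axioms_def)
  ultimately show thesis
    using that by blast
qed

section \<open>Finite p-groups\<close>

lemma finite_p_groupD:
  assumes "finite_p_group p G"
  shows "group G" "finite (carrier G)" "Factorial_Ring.prime p" "\<exists>n. order G = p ^ n"
  using assms by (auto simp: finite_p_group_def)

lemma finite_p_group_subgroup:
  assumes "finite_p_group p G" "subgroup H G"
  shows "finite_p_group p (G\<lparr>carrier := H\<rparr>)"
proof -
  note G = finite_p_groupD[OF assms(1)]
  obtain n where "order G = p ^ n" using G(4) ..
  then have "card H dvd p ^ n"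
    using group.lagrange[OF G(1) assms(2)] by (metis dvd_triv_right)
  then have "\<exists>m. card H = p ^ m"
    using G(3) by (metis divides_primepow_nat)
  then show ?thesis
    using G assms(2) subgroup.subset[OF assms(2)]
    by (auto simp: finite_p_group_def order_def group.subgroup_imp_group intro: finite_subset)
qed

lemma (in group_epi) finite_p_group_image:
  assumes "finite_p_group p G"
  shows "finite_p_group p Q"
proof -
  note G = finite_p_groupD[OF assms]
  obtain n where "order G = p ^ n" using G(4) ..
  then have "order Q dvd p ^ n"
    using order_eq by (metis dvd_triv_left)
  then have "\<exists>m. order Q = p ^ m"
    using G(3) by (metis divides_primepow_nat)
  then show ?thesis
    using G finite_image by (simp add: finite_p_group_def)
qed

lemma (in group_epi) order_image_less:
  assumes "finite (carrier G)" "z \<in> kernel G Q \<phi>" "z \<noteq> \<one>"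
  shows "order Q < order G"
proof -
  have fin: "finite (kernel G Q \<phi>)"
    using assms(1) by (simp add: kernel_def)
  have "card {\<one>, z} \<le> card (kernel G Q \<phi>)"
    by (rule card_mono[OF fin]) (use assms in \<open>auto simp: kernel_def\<close>)
  then have "card (kernel G Q \<phi>) \<ge> 2"
    using assms(3) by auto
  moreover have "order Q > 0"
    using finite_image[OF assms(1)] by (simp add: H.order_gt_0_iff_finite)
  ultimately show ?thesis
    using order_eq by (smt (verit) mult.commute mult_le_mono2 mult_2 less_add_same_cancel1 order_less_le_trans)
qed

lemma (in group_epi) order_image_le:
  assumes "finite (carrier G)"
  shows "order Q \<le> order G"
  using surj assms by (metis card_image_le order_def)

definition centre :: "('a, 'b) monoid_scheme \<Rightarrow> 'a set" where
  "centre G = {z \<in> carrier G. \<forall>g\<in>carrier G. z \<otimes>\<^bsub>G\<^esub> g = g \<otimes>\<^bsub>G\<^esub> z}"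

context group
begin

lemma commute_inv:
  assumes "a \<in> carrier G" "b \<in> carrier G" "a \<otimes> b = b \<otimes> a"
  shows "inv a \<otimes> b = b \<otimes> inv a"
  using assms by (metis inv_closed inv_solve_left inv_solve_right m_assoc m_closed)

lemma subgroup_centralizer:
  assumes "A \<subseteq> carrier G"
  shows "subgroup {z \<in> carrier G. \<forall>a\<in>A. z \<otimes> a = a \<otimes> z} G"
proof (rule subgroupI, goal_cases)
  case 2
  then show ?case using assms by (auto intro!: exI[of _ "\<one>"])
next
  case (3 a)
  then show ?case using assms commute_inv by blast
next
  case (4 a b)
  then show ?case using assms by (auto simp: subset_iff) (metis m_assoc)
qed auto

lemma centre_normal: "centre G \<lhd> G"
proof -
  have "subgroup (centre G) G"
    using subgroup_centralizer[of "carrier G"] by (simp add: centre_def)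
  moreover have "x \<otimes> h \<otimes> inv x = h" if "x \<in> carrier G" "h \<in> centre G" for x h
    using that by (auto simp: centre_def) (metis inv_solve_right m_closed)
  ultimately show ?thesis
    by (simp add: normal_inv_iff)
qed

text \<open>Class equation: the conjugacy classes have \<open>p\<close>-power size and partition the group, so the class
  of the identity cannot be the only one of size one.\<close>

lemma centre_nontrivial:
  assumes "finite_p_group p G" "carrier G \<noteq> {\<one>}"
  obtains z where "z \<in> centre G" "z \<noteq> \<one>"
proof (rule ccontr)
  assume "\<not> thesis"
  then have triv: "z = \<one>" if "z \<in> centre G" for z
    using that \<open>\<And>z. z \<in> centre G \<Longrightarrow> z \<noteq> \<one> \<Longrightarrow> thesis\<close> by blast
  note P = finite_p_groupD[OF assms(1)]
  define act where "act = (\<lambda>g. \<lambda>h \<in> carrier G. g \<otimes> h \<otimes> inv g)"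
  interpret act: group_action G "carrier G" act
    unfolding act_def by (rule action_by_conjugation)
  obtain n where n: "order G = p ^ n"
    using P(4) ..
  have one_orbit: "orbit G act \<one> = {\<one>}"
    by (auto simp: orbit_def act_def intro!: exI[of _ "\<one>"])
  \<comment> \<open>A class of size one consists of a central element, which can only be the identity.\<close>
  have orb_div: "p dvd card Y" if Y: "Y \<in> orbits G (carrier G) act" "Y \<noteq> {\<one>}" for Y
  proof -
    obtain x where x: "x \<in> carrier G" "Y = orbit G act x"
      using Y(1) by (auto simp: orbits_def)
    have "card Y dvd p ^ n"
      using act.orbit_stabilizer_theorem[OF x(1)] x(2) n by (metis dvd_triv_left)
    then obtain m where m: "card Y = p ^ m"
      using P(3) by (metis divides_primepow_nat)
    have "m \<noteq> 0"
    proof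
      assume "m = 0"
      then obtain y where "Y = {y}"
        using m by (auto simp: card_1_singleton_iff)
      moreover have "x \<in> Y"
        using act.orbit_refl[OF x(1)] x(2) by simp
      ultimately have "orbit G act x = {x}"
        using x(2) by auto
      then have "g \<otimes> x \<otimes> inv g = x" if "g \<in> carrier G" for g
        using that x(1) by (auto simp: orbit_def act_def)
      then have "x \<in> centre G"
        using x(1) by (auto simp: centre_def) (metis inv_closed inv_inv inv_solve_right m_closed)
      then show False
        using triv Y(2) x(2) one_orbit by blast
    qed
    then show ?thesis
      using m by simp
  qed
  have one_in: "{\<one>} \<in> orbits G (carrier G) act"
    using one_orbit by (force simp: orbits_def)
  have "(\<Sum>Y\<in>orbits G (carrier G) act. card Y) = order G"
    using act.disjoint_sum[OF P(2), of "\<lambda>_. 1 :: nat"] act.orbits_coverture P(2)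
    by (simp add: order_def)
  moreover have fin: "finite (orbits G (carrier G) act)"
    using P(2) by (simp add: orbits_def)
  ultimately have "order G = 1 + (\<Sum>Y\<in>orbits G (carrier G) act - {{\<one>}}. card Y)"
    using sum.remove[OF fin one_in, of card] by simp
  moreover have "p dvd (\<Sum>Y\<in>orbits G (carrier G) act - {{\<one>}}. card Y)"
    by (rule dvd_sum) (use orb_div in auto)
  moreover have "p dvd order G"
    using assms(2) n order_one_triv_iff by (cases n) auto
  ultimately have "p dvd 1"
    by (metis dvd_add_left_iff)
  then show False
    using P(3) by (metis not_prime_unit)
qed

end

text \<open>Here \<open>G\<close> is the product of \<open>H\<close> with the central subgroup \<open>kernel G Q \<phi>\<close>, so every element of \<open>G\<close>
  acts on \<open>H\<close> by conjugation as an element of \<open>H\<close> does.\<close>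

lemma (in group) normal_if_image_everything:
  assumes epi: "group_epi G Q \<phi>" and ker: "kernel G Q \<phi> \<subseteq> centre G"
    and H: "subgroup H G" and im: "\<phi> ` H = carrier Q"
  shows "H \<lhd> G"
  unfolding normal_inv_iff
proof (intro conjI ballI)
  interpret \<phi>: group_epi G Q \<phi> by fact
  fix g k assume g: "g \<in> carrier G" and k: "k \<in> H"
  have "\<phi> g \<in> \<phi> ` H"
    using g im by simp
  then obtain h where h: "h \<in> H" "\<phi> g = \<phi> h"
    by auto
  define z where "z = inv h \<otimes> g"
  have carr: "h \<in> carrier G" "k \<in> carrier G" "z \<in> carrier G"
    using subgroup.mem_carrier[OF H] h(1) k g by (auto simp: z_def)
  have "\<phi> z = \<one>\<^bsub>Q\<^esub>"
    using h(2) carr g by (simp add: z_def)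
  then have "z \<in> centre G"
    using ker carr \<phi>.mem_kernel_iff by blast
  then have z: "z \<otimes> k = k \<otimes> z"
    using carr by (simp add: centre_def)
  have "g = h \<otimes> z"
    using carr g by (simp add: z_def m_assoc[symmetric])
  then have "g \<otimes> k \<otimes> inv g = h \<otimes> (z \<otimes> k) \<otimes> inv z \<otimes> inv h"
    using carr by (simp add: inv_mult_group m_assoc)
  also have "\<dots> = h \<otimes> k \<otimes> inv h"
    using carr by (simp add: z m_assoc)
  finally show "g \<otimes> k \<otimes> inv g \<in> H"
    using H h(1) k by (simp add: subgroup.m_closed subgroup.m_inv_closed)
qed (fact H)

text \<open>Sylow's theorem provides subgroups of every order \<open>p^m\<close> dividing the group order.\<close>

lemma (in group) abelian_p_group_index_p:
  assumes G: "finite_p_group p G" and nt: "carrier G \<noteq> {\<one>}" and Z: "centre G = carrier G"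
  obtains M where "M \<lhd> G" "card (rcosets M) = p"
proof -
  note P = finite_p_groupD[OF G]
  obtain n where "order G = p ^ n"
    using P(4) ..
  with nt order_one_triv_iff obtain m where m: "order G = p ^ m * p"
    by (cases n) auto
  then obtain M where M: "subgroup M G" "card M = p ^ m"
    using sylow_thm[OF P(3,1) m P(2)] by blast
  have "comm_group G"
    by (rule group_comm_groupI) (use Z in \<open>auto simp: centre_def\<close>)
  then have "M \<lhd> G"
    using M(1) by (rule comm_group.subgroup_imp_normal)
  moreover have "card (rcosets M) * p ^ m = p * p ^ m"
    using lagrange[OF M(1)] m M(2) by (simp only: mult.commute)
  then have "card (rcosets M) = p"
    using prime_gt_0_nat[OF P(3)] by simp
  ultimately show thesis
    using that by blast
qed

text \<open>The induction divides by the
  centre if the image of \<open>H\<close> stays proper.  If the image is everything, then \<open>H\<close> is normal and one divides by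
  \<open>H\<close> instead; should \<open>H\<close> also be trivial, the group is its own centre.\<close>

lemma exists_normal_index_p:
  fixes G :: "nat monoid"
  assumes "finite_p_group p G" "subgroup H G" "H \<noteq> carrier G"
  shows "\<exists>M. M \<lhd> G \<and> H \<subseteq> M \<and> card (rcosets\<^bsub>G\<^esub> M) = p"
  using assms
proof (induction "order G" arbitrary: G H rule: less_induct)
  case less
  note P = finite_p_groupD[OF less.prems(1)]
  interpret group G by (rule P(1))
  \<comment> \<open>A nontrivial quotient in which the image of \<open>H\<close> is proper provides \<open>M\<close> as a preimage.\<close>
  have lift: "\<exists>M. M \<lhd> G \<and> H \<subseteq> M \<and> card (rcosets\<^bsub>G\<^esub> M) = p"
    if epi: "group_epi G Q \<phi>" and small: "z \<in> kernel G Q \<phi>" "z \<noteq> \<one>\<^bsub>G\<^esub>" and im: "\<phi> ` H \<noteq> carrier Q"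
    for Q :: "nat monoid" and \<phi> z
  proof -
    interpret \<phi>: group_epi G Q \<phi> by fact
    have "\<exists>M. M \<lhd> Q \<and> \<phi> ` H \<subseteq> M \<and> card (rcosets\<^bsub>Q\<^esub> M) = p"
      using \<phi>.order_image_less[OF P(2) small] \<phi>.finite_p_group_image[OF less.prems(1)]
        \<phi>.subgroup_img_is_subgroup[OF less.prems(2)] im by (rule less.hyps)
    then obtain M where M: "M \<lhd> Q" "\<phi> ` H \<subseteq> M" "card (rcosets\<^bsub>Q\<^esub> M) = p"
      by blast
    show ?thesis
      using \<phi>.preimage_normal[OF M(1)] M(2,3) subgroup.subset[OF less.prems(2)]
        \<phi>.card_rcosets_preimage[OF P(2) normal_imp_subgroup[OF M(1)]]
      by (intro exI[of _ "{g \<in> carrier G. \<phi> g \<in> M}"]) auto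
  qed
  have nt: "carrier G \<noteq> {\<one>\<^bsub>G\<^esub>}"
    using less.prems(3) subgroup.one_closed[OF less.prems(2)] subgroup.subset[OF less.prems(2)] by auto
  then obtain z where z: "z \<in> centre G" "z \<noteq> \<one>\<^bsub>G\<^esub>"
    using centre_nontrivial[OF less.prems(1)] by blast
  obtain Q :: "nat monoid" and \<phi> where epi: "group_epi G Q \<phi>" and ker: "kernel G Q \<phi> = centre G"
    using quotient_on_nat[OF P(2) centre_normal] .
  interpret \<phi>: group_epi G Q \<phi> by fact
  show ?case
  proof (cases "\<phi> ` H = carrier Q")
    case False
    then show ?thesis
      using lift[OF epi _ z(2)] z(1) ker by blast
  next
    case onto: True
    have H: "H \<lhd> G"
      using normal_if_image_everything[OF epi _ less.prems(2) onto] ker by blast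
    show ?thesis
    proof (cases "H = {\<one>\<^bsub>G\<^esub>}")
      case True
      then have "carrier Q = {\<one>\<^bsub>Q\<^esub>}"
        using onto by auto
      then have "centre G = carrier G"
        using ker by (auto simp: kernel_def)
      then obtain M where M: "M \<lhd> G" "card (rcosets\<^bsub>G\<^esub> M) = p"
        using abelian_p_group_index_p[OF less.prems(1) nt] by blast
      then show ?thesis
        using True subgroup.one_closed[OF normal_imp_subgroup[OF M(1)]] by auto
    next
      case False
      then obtain h where h: "h \<in> H" "h \<noteq> \<one>\<^bsub>G\<^esub>"
        using subgroup.one_closed[OF less.prems(2)] by blast
      obtain R :: "nat monoid" and \<psi> where R: "group_epi G R \<psi>" "kernel G R \<psi> = H"
        using quotient_on_nat[OF P(2) H] .
      interpret \<psi>: group_epi G R \<psi> by fact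
      obtain g where g: "g \<in> carrier G" "g \<notin> H"
        using less.prems(3) subgroup.subset[OF less.prems(2)] by blast
      have "\<psi> ` H \<subseteq> {\<one>\<^bsub>R\<^esub>}"
        using R(2) by (auto simp: kernel_def)
      moreover have "\<psi> g \<noteq> \<one>\<^bsub>R\<^esub>" "\<psi> g \<in> carrier R"
        using g R(2) \<psi>.mem_kernel_iff by auto
      ultimately have "\<psi> ` H \<noteq> carrier R"
        by blast
      then show ?thesis
        using lift[OF R(1) _ h(2)] h(1) R(2) by blast
    qed
  qed
qed

context group
begin

lemma pow_mem_normal_index:
  assumes "finite (carrier G)" "M \<lhd> G" "g \<in> carrier G"
  shows "g [^] card (rcosets M) \<in> M"
proof -
  interpret M: normal M G by fact
  interpret F: group "G Mod M" by (rule M.factorgroup_is_group)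
  have "M #> g [^] card (rcosets M) = (M #> g) [^]\<^bsub>G Mod M\<^esub> card (rcosets M)"
    by (rule M.FactGroup_pow[symmetric]) fact
  also have "\<dots> = \<one>\<^bsub>G Mod M\<^esub>"
    using F.pow_order_eq_1[of "M #> g"] assms(1,3)
    by (auto simp: order_def carrier_FactGroup FactGroup_def RCOSETS_def)
  finally show ?thesis
    using assms(3) by (simp add: coset_join1 M.subset M.subgroup_axioms)
qed

lemma proper_of_index_p:
  assumes "finite_p_group p G" "subgroup M G" "card (rcosets M) = p"
  shows "M \<noteq> carrier G"
proof
  assume "M = carrier G"
  then have "p * order G = order G"
    using lagrange[OF assms(2)] assms(3) by (simp add: order_def)
  then show False
    using finite_p_groupD[OF assms(1)] order_gt_0_iff_finite
    by (metis mult_cancel2 mult_1 not_prime_1 less_irrefl)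
qed

section \<open>Powers of products in class two\<close>

lemma conj_pow:
  assumes "a \<in> carrier G" "g \<in> carrier G"
  shows "(g \<otimes> a \<otimes> inv g) [^] (n::nat) = g \<otimes> a [^] n \<otimes> inv g"
proof (induction n)
  case (Suc n)
  have "inv g \<otimes> (g \<otimes> (a \<otimes> inv g)) = a \<otimes> inv g"
    using assms by (simp add: m_assoc[symmetric])
  then show ?case
    using assms Suc by (simp add: m_assoc)
qed (use assms in simp)

lemma commute_if_conj_fixes:
  assumes "a \<in> carrier G" "g \<in> carrier G" "g \<otimes> a \<otimes> inv g = a"
  shows "g \<otimes> a = a \<otimes> g"
  using assms by (metis inv_solve_right m_closed)

lemma commute_pow:
  assumes "a \<otimes> b = b \<otimes> a" "a \<in> carrier G" "b \<in> carrier G"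
  shows "a [^] (m::nat) \<otimes> b [^] (n::nat) = b [^] n \<otimes> a [^] m"
  using assms by (metis group_commutes_pow nat_pow_closed)

text \<open>Hall's collection formula in class two: moving each of the \<open>n\<close> factors \<open>a\<close> to the left past the factors
  \<open>b\<close> before it produces one factor \<open>d\<close> for every pair.\<close>

lemma pow_mult_class2:
  assumes ab: "a \<in> carrier G" "b \<in> carrier G" "d \<in> carrier G"
    and d: "b \<otimes> a = d \<otimes> (a \<otimes> b)" and comm: "d \<otimes> a = a \<otimes> d" "d \<otimes> b = b \<otimes> d"
  shows "(a \<otimes> b) [^] n = d [^] (n choose 2) \<otimes> (a [^] n \<otimes> b [^] n)"
proof (induction n)
  case (Suc n)
  have swap: "b [^] k \<otimes> a = d [^] k \<otimes> (a \<otimes> b [^] k)" for k :: nat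
  proof (induction k)
    case (Suc k)
    have "b [^] Suc k \<otimes> a = b [^] k \<otimes> (d \<otimes> (a \<otimes> b))"
      using ab d by (simp add: m_assoc)
    also have "\<dots> = d \<otimes> (b [^] k \<otimes> a) \<otimes> b"
      using ab commute_pow[OF comm(2), of 1 k] by (simp add: m_assoc[symmetric])
    also have "\<dots> = d [^] Suc k \<otimes> (a \<otimes> b [^] Suc k)"
      unfolding Suc using ab commute_pow[of d d 1 k] by (simp add: m_assoc[symmetric])
    finally show ?case .
  qed (use ab in simp)
  have "(a \<otimes> b) [^] Suc n = d [^] (n choose 2) \<otimes> (a [^] n \<otimes> (b [^] n \<otimes> a) \<otimes> b)"
    using ab Suc by (simp add: m_assoc)
  also have "\<dots> = d [^] (n choose 2) \<otimes> ((a [^] n \<otimes> d [^] n) \<otimes> (a \<otimes> b [^] n) \<otimes> b)"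
    unfolding swap using ab by (simp add: m_assoc)
  also have "\<dots> = (d [^] (n choose 2) \<otimes> d [^] n) \<otimes> (a [^] n \<otimes> a \<otimes> (b [^] n \<otimes> b))"
    unfolding commute_pow[OF comm(1) ab(3,1), of n n, symmetric] using ab by (simp add: m_assoc)
  also have "d [^] (n choose 2) \<otimes> d [^] n = d [^] (Suc n choose 2)"
    using ab by (simp add: nat_pow_mult numeral_2_eq_2 add.commute)
  finally show ?case
    by simp
qed (use ab in \<open>simp add: numeral_2_eq_2\<close>)

text \<open>For odd \<open>p\<close> the exponent of \<open>d\<close> in the collection formula, \<open>p (p - 1) / 2\<close>, is a multiple of \<open>p\<close>.\<close>

lemma pow_mult_class2_odd_prime:
  fixes p :: nat
  assumes p: "Factorial_Ring.prime p" "odd p"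
    and ab: "a \<in> carrier G" "b \<in> carrier G" "d \<in> carrier G"
    and d: "b \<otimes> a = d \<otimes> (a \<otimes> b)" and comm: "d \<otimes> a = a \<otimes> d" "d \<otimes> b = b \<otimes> d"
    and dp: "d [^] p = \<one>"
  shows "(a \<otimes> b) [^] p = a [^] p \<otimes> b [^] p"
proof -
  have "p choose 2 = p * ((p - 1) div 2)"
    using p(2) by (simp add: choose_two div_mult_swap)
  then have "d [^] (p choose 2) = \<one>"
    using ab dp by (metis nat_pow_one nat_pow_pow)
  then show ?thesis
    using pow_mult_class2[OF ab d comm, of p] ab by simp
qed

text \<open>The conjugate \<open>d a\<close> of \<open>a\<close> has order dividing \<open>p\<close>, hence so has \<open>d\<close>.\<close>

lemma pow_mult_class2_order_p:
  fixes p :: nat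
  assumes p: "Factorial_Ring.prime p" "odd p"
    and ab: "a \<in> carrier G" "b \<in> carrier G" "d \<in> carrier G"
    and d: "b \<otimes> a = d \<otimes> (a \<otimes> b)" and comm: "d \<otimes> a = a \<otimes> d" "d \<otimes> b = b \<otimes> d"
    and ap: "a [^] p = \<one>"
  shows "(a \<otimes> b) [^] p = b [^] p"
proof -
  have "b \<otimes> a \<otimes> inv b = d \<otimes> a"
    using ab d by (simp add: m_assoc)
  then have "(d \<otimes> a) [^] p = \<one>"
    using conj_pow[OF ab(1,2), of p] ab ap by simp
  then have "d [^] p = \<one>"
    using pow_mult_distrib[OF comm(1) ab(3,1), of p] ab ap by simp
  then show ?thesis
    using pow_mult_class2_odd_prime[OF p ab d comm] ap ab by simp
qed

end

section \<open>Commutators and the subgroup generated by the p-th powers\<close>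

definition commutator :: "('a, 'b) monoid_scheme \<Rightarrow> 'a \<Rightarrow> 'a \<Rightarrow> 'a" where
  "commutator G a b = a \<otimes>\<^bsub>G\<^esub> b \<otimes>\<^bsub>G\<^esub> inv\<^bsub>G\<^esub> a \<otimes>\<^bsub>G\<^esub> inv\<^bsub>G\<^esub> b"

context group
begin

lemma commutator_closed [simp, intro]:
  "a \<in> carrier G \<Longrightarrow> b \<in> carrier G \<Longrightarrow> commutator G a b \<in> carrier G"
  by (simp add: commutator_def)

lemma commutator_mult_right:
  "a \<in> carrier G \<Longrightarrow> b \<in> carrier G \<Longrightarrow> commutator G a b \<otimes> b = a \<otimes> b \<otimes> inv a"
  by (simp add: commutator_def m_assoc)

lemma commutator_mult:
  "a \<in> carrier G \<Longrightarrow> b \<in> carrier G \<Longrightarrow> a \<otimes> b = commutator G a b \<otimes> (b \<otimes> a)"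
  using commutator_mult_right[of a b] by (simp add: m_assoc[symmetric]) (simp add: m_assoc)

lemma commutator_eq_one_iff:
  assumes "a \<in> carrier G" "b \<in> carrier G"
  shows "commutator G a b = \<one> \<longleftrightarrow> a \<otimes> b = b \<otimes> a"
proof
  assume "commutator G a b = \<one>"
  then show "a \<otimes> b = b \<otimes> a"
    using commutator_mult[OF assms] assms by simp
next
  assume "a \<otimes> b = b \<otimes> a"
  then show "commutator G a b = \<one>"
    using assms by (simp add: commutator_def m_assoc)
qed

lemma commutator_normal1:
  assumes "N \<lhd> G" "a \<in> N" "b \<in> carrier G"
  shows "commutator G a b \<in> N"
proof -
  interpret normal N G by fact
  have "b \<otimes> inv a \<otimes> inv b \<in> N"
    using assms by (simp add: inv_op_closed2)
  then show ?thesis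
    using assms by (simp add: commutator_def m_assoc)
qed

lemma commutator_normal2:
  assumes "N \<lhd> G" "a \<in> carrier G" "b \<in> N"
  shows "commutator G a b \<in> N"
proof -
  interpret normal N G by fact
  show ?thesis
    using assms by (simp add: commutator_def inv_op_closed2)
qed

lemma commutator_restrict:
  assumes "subgroup H G" "a \<in> H" "b \<in> H"
  shows "commutator (G\<lparr>carrier := H\<rparr>) a b = commutator G a b"
  using assms by (simp add: commutator_def)

lemma generate_commute:
  assumes "A \<subseteq> carrier G" "\<And>a b. a \<in> A \<Longrightarrow> b \<in> A \<Longrightarrow> a \<otimes> b = b \<otimes> a"
    and "x \<in> generate G A" "y \<in> generate G A"
  shows "x \<otimes> y = y \<otimes> x"
proof -
  have *: "generate G A \<subseteq> {z \<in> carrier G. \<forall>a\<in>A. z \<otimes> a = a \<otimes> z}"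
    by (rule generate_subgroup_incl[OF _ subgroup_centralizer]) (use assms(1,2) in auto)
  have "generate G A \<subseteq> {z \<in> carrier G. \<forall>a\<in>generate G A. z \<otimes> a = a \<otimes> z}"
    by (rule generate_subgroup_incl[OF _ subgroup_centralizer])
       (use * assms(1) generate_incl in \<open>auto simp: subset_iff\<close>)
  then show ?thesis
    using assms(3,4) by auto
qed

lemma agemo_subgroup: "subgroup (agemo p k G) G"
  unfolding agemo_def by (rule generate_is_subgroup) auto

lemma agemo_normal: "agemo p k G \<lhd> G"
  unfolding agemo_def
proof (rule normal_generateI)
  fix h g assume "h \<in> {g [^] p ^ k |g. g \<in> carrier G}" and g: "g \<in> carrier G"
  then obtain u where "u \<in> carrier G" "h = u [^] p ^ k"
    by blast
  then show "g \<otimes> h \<otimes> inv g \<in> {g [^] p ^ k |g. g \<in> carrier G}"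
    using g conj_pow by (intro CollectI exI[of _ "g \<otimes> u \<otimes> inv g"]) simp
qed auto

lemma pow_mem_agemo: "g \<in> carrier G \<Longrightarrow> g [^] p \<in> agemo p 1 G"
  unfolding agemo_def by (rule generate.incl) auto

lemma agemo_least:
  assumes "subgroup K G" "\<And>g. g \<in> carrier G \<Longrightarrow> g [^] p \<in> K"
  shows "agemo p 1 G \<subseteq> K"
  unfolding agemo_def by (rule generate_subgroup_incl) (use assms in auto)

lemma agemo_restrict:
  assumes "subgroup H G"
  shows "agemo p k (G\<lparr>carrier := H\<rparr>) = generate G {h [^] p ^ k |h. h \<in> H}"
proof -
  interpret H: group "G\<lparr>carrier := H\<rparr>"
    using assms by (rule subgroup_imp_group)
  have "{h [^] p ^ k |h. h \<in> H} \<subseteq> H"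
    using H.nat_pow_closed by (auto simp: nat_pow_consistent[of _ _ H])
  then have "generate (G\<lparr>carrier := H\<rparr>) {h [^] p ^ k |h. h \<in> H} = generate G {h [^] p ^ k |h. h \<in> H}"
    using assms by (rule generate_consistent)
  then show ?thesis
    by (simp add: agemo_def nat_pow_consistent[of _ _ H])
qed

lemma agemo_restrict_mono:
  assumes "subgroup H G" "subgroup K G" "H \<subseteq> K"
  shows "agemo p k (G\<lparr>carrier := H\<rparr>) \<subseteq> agemo p k (G\<lparr>carrier := K\<rparr>)"
  unfolding agemo_restrict[OF assms(1)] agemo_restrict[OF assms(2)]
  by (rule mono_generate) (use assms(3) in auto)

lemma agemo_restrict_normal:
  assumes "H \<lhd> G"
  shows "agemo p k (G\<lparr>carrier := H\<rparr>) \<lhd> G"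
  unfolding agemo_restrict[OF normal_imp_subgroup[OF assms]]
proof (rule normal_generateI)
  interpret H: normal H G by fact
  show "{h [^] p ^ k |h. h \<in> H} \<subseteq> carrier G"
    by auto
  fix h g assume "h \<in> {h [^] p ^ k |h. h \<in> H}" and g: "g \<in> carrier G"
  then obtain u where "u \<in> H" "h = u [^] p ^ k"
    by blast
  then show "g \<otimes> h \<otimes> inv g \<in> {h [^] p ^ k |h. h \<in> H}"
    using g conj_pow H.inv_op_closed2 by (intro CollectI exI[of _ "g \<otimes> u \<otimes> inv g"]) simp
qed

lemma powerful_iff:
  assumes "finite_p_group p G"
  shows "powerful p G \<longleftrightarrow> (\<forall>a\<in>carrier G. \<forall>b\<in>carrier G. commutator G a b \<in> agemo p 1 G)"
proof -
  have "derived G (carrier G) \<subseteq> agemo p 1 G \<longleftrightarrow> derived_set G (carrier G) \<subseteq> agemo p 1 G"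
  proof
    assume *: "derived G (carrier G) \<subseteq> agemo p 1 G"
    show "derived_set G (carrier G) \<subseteq> agemo p 1 G"
      by (rule subset_trans[OF _ *]) (unfold derived_def, intro subsetI generate.incl)
  next
    assume "derived_set G (carrier G) \<subseteq> agemo p 1 G"
    then show "derived G (carrier G) \<subseteq> agemo p 1 G"
      unfolding derived_def by (rule generate_subgroup_incl[OF _ agemo_subgroup])
  qed
  then show ?thesis
    using assms by (auto simp: powerful_def commutator_def)
qed

lemma powerful_restrictI:
  assumes "finite_p_group p G" "subgroup H G"
    and "\<And>a b. a \<in> H \<Longrightarrow> b \<in> H \<Longrightarrow> commutator G a b \<in> agemo p 1 (G\<lparr>carrier := H\<rparr>)"
  shows "powerful p (G\<lparr>carrier := H\<rparr>)"
  using group.powerful_iff[OF subgroup_imp_group[OF assms(2)] finite_p_group_subgroup[OF assms(1,2)]]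
    assms(3) commutator_restrict[OF assms(2)] by simp

lemma agemo_subset_normal_index_p:
  assumes "finite_p_group p G" "M \<lhd> G" "card (rcosets M) = p"
  shows "agemo p 1 G \<subseteq> M"
  using pow_mem_normal_index[OF finite_p_groupD(2)[OF assms(1)] assms(2)] assms(3)
  by (intro agemo_least normal_imp_subgroup assms(2)) auto

end

context group_epi
begin

lemma image_commutator:
  "a \<in> carrier G \<Longrightarrow> b \<in> carrier G \<Longrightarrow> \<phi> (commutator G a b) = commutator Q (\<phi> a) (\<phi> b)"
  by (simp add: commutator_def)

lemma image_agemo: "\<phi> ` agemo p k G = agemo p k Q"
proof -
  have "\<phi> ` {g [^] p ^ k |g. g \<in> carrier G} = {q [^]\<^bsub>Q\<^esub> p ^ k |q. q \<in> carrier Q}"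
    unfolding surj[symmetric] using hom_nat_pow by (auto simp: image_iff) (metis hom_nat_pow)
  then show ?thesis
    using generate_img[of "{g [^] p ^ k |g. g \<in> carrier G}"] by (auto simp: agemo_def)
qed

lemma image_mem_agemo: "h \<in> agemo p k G \<Longrightarrow> \<phi> h \<in> agemo p k Q"
  unfolding image_agemo[symmetric] by (rule imageI)

lemma lift_agemo:
  assumes "q \<in> agemo p k Q"
  obtains h where "h \<in> agemo p k G" "h \<in> carrier G" "q = \<phi> h"
proof -
  have "q \<in> \<phi> ` agemo p k G"
    using assms unfolding image_agemo .
  then show thesis
    using that subgroup.subset[OF G.agemo_subgroup] by auto
qed

lemma powerful_image:
  assumes "powerful p G"
  shows "powerful p Q"
proof -
  have "derived Q (carrier Q) = \<phi> ` derived G (carrier G)"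
    using derived_img[of "carrier G"] surj by simp
  also have "\<dots> \<subseteq> agemo p 1 Q"
    using assms image_agemo[of p 1] by (auto simp: powerful_def)
  finally show ?thesis
    using assms finite_p_group_image by (simp add: powerful_def)
qed

end

section \<open>Powerful groups\<close>

text \<open>Induction through \<open>G / Z(G)\<close>: there the image of the commutator \<open>m = [g, n]\<close> is central, so that
  \<open>[n, m]\<close> is central in \<open>G\<close> and the class-two formula gives \<open>(m n)^p = n^p\<close>.  As \<open>m n\<close> is the
  conjugate of \<open>n\<close> by \<open>g\<close>, this says that \<open>g\<close> commutes with \<open>n^p\<close>.\<close>

lemma agemo_central_if_exponent_p:
  fixes G :: "nat monoid"
  assumes "odd p" "powerful p G" "\<And>h. h \<in> agemo p 1 G \<Longrightarrow> h [^]\<^bsub>G\<^esub> p = \<one>\<^bsub>G\<^esub>"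
  shows "agemo p 1 G \<subseteq> centre G"
  using assms
proof (induction "order G" arbitrary: G rule: less_induct)
  case less
  have fpg: "finite_p_group p G"
    using less.prems(2) by (simp add: powerful_def)
  note P = finite_p_groupD[OF fpg]
  interpret group G by (rule P(1))
  show ?case
  proof (cases "carrier G = {\<one>\<^bsub>G\<^esub>}")
    case True
    then show ?thesis
      using subgroup.subset[OF agemo_subgroup, of p 1] by (auto simp: centre_def)
  next
    case False
    obtain z where z: "z \<in> centre G" "z \<noteq> \<one>\<^bsub>G\<^esub>"
      using centre_nontrivial[OF fpg False] by blast
    obtain Q :: "nat monoid" and \<phi> where epi: "group_epi G Q \<phi>" and ker: "kernel G Q \<phi> = centre G"
      using quotient_on_nat[OF P(2) centre_normal] .
    interpret \<phi>: group_epi G Q \<phi> by fact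
    have cQ: "agemo p 1 Q \<subseteq> centre Q"
    proof (rule less.hyps)
      show "order Q < order G"
        using \<phi>.order_image_less[OF P(2) _ z(2)] z(1) ker by simp
      show "powerful p Q"
        using \<phi>.powerful_image[OF less.prems(2)] .
      fix h assume "h \<in> agemo p 1 Q"
      then obtain k where "k \<in> agemo p 1 G" "k \<in> carrier G" "h = \<phi> k"
        by (rule \<phi>.lift_agemo)
      then show "h [^]\<^bsub>Q\<^esub> p = \<one>\<^bsub>Q\<^esub>"
        using less.prems(3)[of k] \<phi>.hom_nat_pow[of k p] by simp
    qed fact
    have "n [^]\<^bsub>G\<^esub> p \<in> centre G" if n: "n \<in> carrier G" for n
    proof -
      have "g \<otimes>\<^bsub>G\<^esub> n [^]\<^bsub>G\<^esub> p = n [^]\<^bsub>G\<^esub> p \<otimes>\<^bsub>G\<^esub> g" if g: "g \<in> carrier G" for g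
      proof -
        define m where "m = commutator G g n"
        define d where "d = commutator G n m"
        have m: "m \<in> agemo p 1 G"
          using less.prems(2) n g unfolding powerful_iff[OF fpg] m_def by blast
        have carr: "m \<in> carrier G" "d \<in> carrier G"
          using n g by (auto simp: m_def d_def)
        have "\<phi> m \<in> centre Q"
          using cQ \<phi>.image_mem_agemo[OF m] by blast
        then have "\<phi> n \<otimes>\<^bsub>Q\<^esub> \<phi> m = \<phi> m \<otimes>\<^bsub>Q\<^esub> \<phi> n"
          using n by (simp add: centre_def)
        then have "\<phi> d = \<one>\<^bsub>Q\<^esub>"
          using n carr by (simp add: d_def \<phi>.image_commutator \<phi>.H.commutator_eq_one_iff)
        then have d: "d \<in> centre G"
          using ker carr \<phi>.mem_kernel_iff by blast
        have "(m \<otimes>\<^bsub>G\<^esub> n) [^]\<^bsub>G\<^esub> p = n [^]\<^bsub>G\<^esub> p"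
        proof (rule pow_mult_class2_order_p[OF P(3) less.prems(1) carr(1) n carr(2)])
          show "n \<otimes>\<^bsub>G\<^esub> m = d \<otimes>\<^bsub>G\<^esub> (m \<otimes>\<^bsub>G\<^esub> n)"
            using commutator_mult[OF n carr(1)] by (simp add: d_def)
        qed (use d n carr less.prems(3)[OF m] in \<open>auto simp: centre_def\<close>)
        then have "g \<otimes>\<^bsub>G\<^esub> n [^]\<^bsub>G\<^esub> p \<otimes>\<^bsub>G\<^esub> inv\<^bsub>G\<^esub> g = n [^]\<^bsub>G\<^esub> p"
          using n g by (simp add: m_def commutator_mult_right conj_pow)
        then show ?thesis
          using n g by (intro commute_if_conj_fixes) auto
      qed
      then show ?thesis
        using n by (auto simp: centre_def)
    qed
    then show ?thesis
      by (intro agemo_least normal_imp_subgroup[OF centre_normal])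
  qed
qed

definition agemo2 :: "nat \<Rightarrow> ('a, 'b) monoid_scheme \<Rightarrow> 'a set" where
  "agemo2 p G = agemo p 1 (G\<lparr>carrier := agemo p 1 G\<rparr>)"

context group
begin

lemma agemo2_normal: "agemo2 p G \<lhd> G"
  unfolding agemo2_def by (rule agemo_restrict_normal[OF agemo_normal])

lemma pow_mem_agemo2:
  assumes "h \<in> agemo p 1 G"
  shows "h [^] p \<in> agemo2 p G"
  using group.pow_mem_agemo[OF subgroup_imp_group[OF agemo_subgroup], of h p 1 p] assms
  by (simp add: agemo2_def nat_pow_consistent[symmetric])

lemma agemo2_subset_agemo_restrict:
  assumes "subgroup K G" "agemo p 1 G \<subseteq> K"
  shows "agemo2 p G \<subseteq> agemo p 1 (G\<lparr>carrier := K\<rparr>)"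
  unfolding agemo2_def by (rule agemo_restrict_mono[OF agemo_subgroup assms])

text \<open>Modulo \<open>agemo2 p G\<close>, the \<open>p\<close>-th powers generate a central subgroup of exponent dividing \<open>p\<close>.  All the
  classical facts about powerful groups below are read off from this quotient.\<close>

lemma powerful_quotient_agemo2:
  assumes "odd p" "powerful p G"
  obtains Q :: "nat monoid" and \<phi>
  where "group_epi G Q \<phi>" "kernel G Q \<phi> = agemo2 p G" "powerful p Q"
    "agemo p 1 Q \<subseteq> centre Q" "\<forall>h\<in>agemo p 1 Q. h [^]\<^bsub>Q\<^esub> p = \<one>\<^bsub>Q\<^esub>"
proof -
  have "finite_p_group p G"
    using assms by (simp add: powerful_def)
  then have "finite (carrier G)"
    by (rule finite_p_groupD)
  then obtain Q :: "nat monoid" and \<phi> where epi: "group_epi G Q \<phi>" and ker: "kernel G Q \<phi> = agemo2 p G"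
    using quotient_on_nat[OF _ agemo2_normal] by blast
  interpret \<phi>: group_epi G Q \<phi> by fact
  have pow: "h [^]\<^bsub>Q\<^esub> p = \<one>\<^bsub>Q\<^esub>" if h: "h \<in> agemo p 1 Q" for h
  proof -
    obtain k where k: "k \<in> agemo p 1 G" "k \<in> carrier G" "h = \<phi> k"
      using \<phi>.lift_agemo[OF h] .
    have "k [^] p \<in> kernel G Q \<phi>"
      unfolding ker by (rule pow_mem_agemo2) (rule k(1))
    then show ?thesis
      using k(2,3) \<phi>.hom_nat_pow[of k p] by (simp add: kernel_def)
  qed
  show thesis
    using that[OF epi ker \<phi>.powerful_image[OF assms(2)]
        agemo_central_if_exponent_p[OF assms(1) \<phi>.powerful_image[OF assms(2)] pow]] pow by blast
qed

lemma commutator_agemo_mem_agemo2: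
  assumes "odd p" "powerful p G" "h \<in> agemo p 1 G" "g \<in> carrier G"
  shows "commutator G h g \<in> agemo2 p G"
proof -
  obtain Q :: "nat monoid" and \<phi> where epi: "group_epi G Q \<phi>" and ker: "kernel G Q \<phi> = agemo2 p G"
    and "powerful p Q" and Q: "agemo p 1 Q \<subseteq> centre Q" and "\<forall>h\<in>agemo p 1 Q. h [^]\<^bsub>Q\<^esub> p = \<one>\<^bsub>Q\<^esub>"
    using powerful_quotient_agemo2[OF assms(1,2)] .
  interpret \<phi>: group_epi G Q \<phi> by fact
  have h: "h \<in> carrier G"
    using assms(3) subgroup.subset[OF agemo_subgroup] by blast
  have "\<phi> h \<in> centre Q"
    using Q \<phi>.image_mem_agemo[OF assms(3)] by blast
  then have "\<phi> (commutator G h g) = \<one>\<^bsub>Q\<^esub>"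
    using h assms(4) by (simp add: \<phi>.image_commutator \<phi>.H.commutator_eq_one_iff centre_def)
  then show ?thesis
    using \<phi>.mem_kernel_iff h assms(4) ker by blast
qed

lemma powerful_agemo:
  assumes "odd p" "powerful p G"
  shows "powerful p (G\<lparr>carrier := agemo p 1 G\<rparr>)"
proof (rule powerful_restrictI[OF _ agemo_subgroup])
  show "finite_p_group p G"
    using assms by (simp add: powerful_def)
  show "commutator G a b \<in> agemo p 1 (G\<lparr>carrier := agemo p 1 G\<rparr>)"
    if "a \<in> agemo p 1 G" "b \<in> agemo p 1 G" for a b
    using commutator_agemo_mem_agemo2[OF assms that(1) subgroup.mem_carrier[OF agemo_subgroup that(2)]]
    by (simp add: agemo2_def)
qed

lemma pow_mult_mod_agemo2:
  assumes "odd p" "powerful p G" "h \<in> agemo p 1 G" "g \<in> carrier G"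
  shows "(h \<otimes> g) [^] p \<otimes> inv (g [^] p) \<in> agemo2 p G"
proof -
  obtain Q :: "nat monoid" and \<phi> where epi: "group_epi G Q \<phi>" and ker: "kernel G Q \<phi> = agemo2 p G"
    and "powerful p Q"
    and Q: "agemo p 1 Q \<subseteq> centre Q" "\<forall>h\<in>agemo p 1 Q. h [^]\<^bsub>Q\<^esub> p = \<one>\<^bsub>Q\<^esub>"
    using powerful_quotient_agemo2[OF assms(1,2)] .
  interpret \<phi>: group_epi G Q \<phi> by fact
  have h: "h \<in> carrier G"
    using assms(3) subgroup.subset[OF agemo_subgroup] by blast
  have im: "\<phi> h \<in> agemo p 1 Q"
    by (rule \<phi>.image_mem_agemo) (rule assms(3))
  then have "\<phi> h \<otimes>\<^bsub>Q\<^esub> \<phi> g = \<phi> g \<otimes>\<^bsub>Q\<^esub> \<phi> h"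
    using Q(1) assms(4) by (auto simp: centre_def)
  then have "(\<phi> h \<otimes>\<^bsub>Q\<^esub> \<phi> g) [^]\<^bsub>Q\<^esub> p = \<phi> h [^]\<^bsub>Q\<^esub> p \<otimes>\<^bsub>Q\<^esub> \<phi> g [^]\<^bsub>Q\<^esub> p"
    using h assms(4) by (intro \<phi>.H.pow_mult_distrib) auto
  then have "\<phi> ((h \<otimes> g) [^] p \<otimes> inv (g [^] p)) = \<one>\<^bsub>Q\<^esub>"
    using h assms(4) Q(2)[rule_format, OF im] by (simp add: \<phi>.hom_nat_pow)
  then show ?thesis
    using \<phi>.mem_kernel_iff[of "(h \<otimes> g) [^] p \<otimes> inv (g [^] p)"] h assms(4) ker by simp
qed

definition adjoin_agemo :: "nat \<Rightarrow> 'a \<Rightarrow> 'a set" where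
  "adjoin_agemo p g = generate G (insert g (agemo p 1 G))"

lemma adjoin_agemo_subgroup: "g \<in> carrier G \<Longrightarrow> subgroup (adjoin_agemo p g) G"
  unfolding adjoin_agemo_def
  by (rule generate_is_subgroup) (use subgroup.subset[OF agemo_subgroup] in auto)

lemma mem_adjoin_agemo: "g \<in> adjoin_agemo p g" "agemo p 1 G \<subseteq> adjoin_agemo p g"
  unfolding adjoin_agemo_def by (auto intro: generate.incl)

text \<open>In the quotient by \<open>agemo2 p G\<close> this subgroup is generated by one element and central ones, hence
  abelian; so its commutators lie in \<open>agemo2 p G\<close>, which consists of products of \<open>p\<close>-th
  powers of its elements and their inverses.\<close>

lemma powerful_adjoin_agemo:
  assumes "odd p" "powerful p G" "g \<in> carrier G"
  shows "powerful p (G\<lparr>carrier := adjoin_agemo p g\<rparr>)"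
proof (rule powerful_restrictI[OF _ adjoin_agemo_subgroup[OF assms(3)]])
  show "finite_p_group p G"
    using assms by (simp add: powerful_def)
  fix a b assume ab: "a \<in> adjoin_agemo p g" "b \<in> adjoin_agemo p g"
  obtain Q :: "nat monoid" and \<phi> where epi: "group_epi G Q \<phi>" and ker: "kernel G Q \<phi> = agemo2 p G"
    and "powerful p Q" and Q: "agemo p 1 Q \<subseteq> centre Q" and "\<forall>h\<in>agemo p 1 Q. h [^]\<^bsub>Q\<^esub> p = \<one>\<^bsub>Q\<^esub>"
    using powerful_quotient_agemo2[OF assms(1,2)] .
  interpret \<phi>: group_epi G Q \<phi> by fact
  have carr: "a \<in> carrier G" "b \<in> carrier G"
    using ab subgroup.subset[OF adjoin_agemo_subgroup[OF assms(3)]] by auto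
  have "\<phi> ` adjoin_agemo p g = generate Q (insert (\<phi> g) (agemo p 1 Q))"
    using \<phi>.generate_img[of "insert g (agemo p 1 G)"] \<phi>.image_agemo[of p 1] assms(3)
      subgroup.subset[OF agemo_subgroup] by (simp add: adjoin_agemo_def)
  then have "\<phi> a \<in> generate Q (insert (\<phi> g) (agemo p 1 Q))" "\<phi> b \<in> generate Q (insert (\<phi> g) (agemo p 1 Q))"
    using ab by blast+
  then have "\<phi> a \<otimes>\<^bsub>Q\<^esub> \<phi> b = \<phi> b \<otimes>\<^bsub>Q\<^esub> \<phi> a"
    by (rule \<phi>.H.generate_commute[rotated 2])
       (use Q assms(3) subgroup.subset[OF \<phi>.H.agemo_subgroup] in \<open>auto simp: centre_def subset_iff\<close>)
  then have "\<phi> (commutator G a b) = \<one>\<^bsub>Q\<^esub>"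
    using carr by (simp add: \<phi>.image_commutator \<phi>.H.commutator_eq_one_iff)
  then have "commutator G a b \<in> agemo2 p G"
    using \<phi>.mem_kernel_iff carr ker by blast
  then show "commutator G a b \<in> agemo p 1 (G\<lparr>carrier := adjoin_agemo p g\<rparr>)"
    using agemo2_subset_agemo_restrict[OF adjoin_agemo_subgroup[OF assms(3)] mem_adjoin_agemo(2)] by blast
qed

lemma conj_mem_adjoin_agemo:
  assumes "powerful p G" "g \<in> carrier G" "x \<in> carrier G"
  shows "x \<otimes> g \<otimes> inv x \<in> adjoin_agemo p g"
proof -
  have "finite_p_group p G"
    using assms by (simp add: powerful_def)
  then have "commutator G x g \<in> adjoin_agemo p g"
    using assms powerful_iff mem_adjoin_agemo(2) by blast
  then have "commutator G x g \<otimes> g \<in> adjoin_agemo p g"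
    using subgroup.m_closed[OF adjoin_agemo_subgroup[OF assms(2)]] mem_adjoin_agemo(1) by blast
  then show ?thesis
    using assms by (simp add: commutator_mult_right)
qed

lemma commute_if_generate_single:
  assumes "g \<in> carrier G" "generate G {g} = carrier G" "a \<in> carrier G" "b \<in> carrier G"
  shows "a \<otimes> b = b \<otimes> a"
  by (rule generate_commute[of "{g}"]) (use assms in auto)

end

text \<open>A maximal subgroup containing \<open>g\<close> exists because \<open>G\<close> is not cyclic, and every maximal subgroup
  contains all \<open>p\<close>-th powers.\<close>

lemma adjoin_agemo_proper:
  fixes G :: "nat monoid"
  assumes "finite_p_group p G" "g \<in> carrier G"
    and "a \<in> carrier G" "b \<in> carrier G" "a \<otimes>\<^bsub>G\<^esub> b \<noteq> b \<otimes>\<^bsub>G\<^esub> a"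
  shows "card (group.adjoin_agemo G p g) < order G"
proof -
  note P = finite_p_groupD[OF assms(1)]
  interpret group G by (rule P(1))
  have "generate G {g} \<noteq> carrier G"
    using commute_if_generate_single assms(2-5) by blast
  then obtain M where M: "M \<lhd> G" "generate G {g} \<subseteq> M" "card (rcosets\<^bsub>G\<^esub> M) = p"
    using exists_normal_index_p[OF assms(1) generate_is_subgroup] assms(2) by blast
  have "g \<in> M"
    using M(2) generate.incl by (metis singletonI subsetD)
  then have "adjoin_agemo p g \<subseteq> M"
    unfolding adjoin_agemo_def
    using agemo_subset_normal_index_p[OF assms(1) M(1,3)] normal_imp_subgroup[OF M(1)]
    by (intro generate_subgroup_incl) auto
  moreover have "M \<subset> carrier G"
    using proper_of_index_p[OF assms(1) normal_imp_subgroup[OF M(1)] M(3)]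
      subgroup.subset[OF normal_imp_subgroup[OF M(1)]] by blast
  ultimately show ?thesis
    using P(2) unfolding order_def by (meson order_le_less_trans psubset_card_mono)
qed

lemma (in group) agemo_eq_powers_if_pow_mult:
  assumes "\<And>a b. a \<in> carrier G \<Longrightarrow> b \<in> carrier G \<Longrightarrow> (a \<otimes> b) [^] p = a [^] p \<otimes> b [^] p"
    and "h \<in> agemo p 1 G"
  obtains u where "u \<in> carrier G" "h = u [^] p"
proof -
  have "subgroup {u [^] p |u. u \<in> carrier G} G"
  proof (rule subgroupI)
    show "inv a \<in> {u [^] p |u. u \<in> carrier G}" if a: "a \<in> {u [^] p |u. u \<in> carrier G}" for a
    proof -
      obtain u where "u \<in> carrier G" "a = u [^] p"
        using a by blast
      then show ?thesis
        by (intro CollectI exI[of _ "inv u"]) (simp add: nat_pow_inv)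
    qed
    show "a \<otimes> b \<in> {u [^] p |u. u \<in> carrier G}"
      if ab: "a \<in> {u [^] p |u. u \<in> carrier G}" "b \<in> {u [^] p |u. u \<in> carrier G}" for a b
    proof -
      obtain u v where "u \<in> carrier G" "a = u [^] p" "v \<in> carrier G" "b = v [^] p"
        using ab by blast
      then show ?thesis
        using assms(1) by (intro CollectI exI[of _ "u \<otimes> v"]) simp
    qed
  qed auto
  then have "agemo p 1 G \<subseteq> {u [^] p |u. u \<in> carrier G}"
    by (rule agemo_least) auto
  then show thesis
    using assms(2) that by blast
qed

text \<open>Modulo \<open>agemo2 p G\<close>, raising to the power \<open>p\<close> is multiplicative, so \<open>h = k g^p\<close> with \<open>k\<close> in
  \<open>agemo2 p G\<close>.  Both factors lie in the corresponding subgroup of the group generated by \<open>g\<close> and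
  the \<open>p\<close>-th powers, which is powerful and, unless \<open>G\<close> is abelian, smaller than \<open>G\<close>.\<close>

lemma agemo_eq_powers:
  fixes G :: "nat monoid"
  assumes "odd p" "powerful p G" "h \<in> agemo p 1 G"
  shows "\<exists>u\<in>carrier G. h = u [^]\<^bsub>G\<^esub> p"
  using assms
proof (induction "order G" arbitrary: G h rule: less_induct)
  case less
  have fpg: "finite_p_group p G"
    using less.prems(2) by (simp add: powerful_def)
  note P = finite_p_groupD[OF fpg]
  interpret group G by (rule P(1))
  show ?case
  proof (cases "\<forall>a\<in>carrier G. \<forall>b\<in>carrier G. a \<otimes>\<^bsub>G\<^esub> b = b \<otimes>\<^bsub>G\<^esub> a")
    case True
    then have "(a \<otimes>\<^bsub>G\<^esub> b) [^]\<^bsub>G\<^esub> p = a [^]\<^bsub>G\<^esub> p \<otimes>\<^bsub>G\<^esub> b [^]\<^bsub>G\<^esub> p" if "a \<in> carrier G" "b \<in> carrier G" for a b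
      using that by (simp add: pow_mult_distrib)
    then show ?thesis
      using agemo_eq_powers_if_pow_mult less.prems(3) by blast
  next
    case False
    then obtain a b where ab: "a \<in> carrier G" "b \<in> carrier G" "a \<otimes>\<^bsub>G\<^esub> b \<noteq> b \<otimes>\<^bsub>G\<^esub> a"
      by blast
    obtain Q :: "nat monoid" and \<phi> where epi: "group_epi G Q \<phi>" and ker: "kernel G Q \<phi> = agemo2 p G"
      and Qpow: "powerful p Q" and Q: "agemo p 1 Q \<subseteq> centre Q" "\<forall>h\<in>agemo p 1 Q. h [^]\<^bsub>Q\<^esub> p = \<one>\<^bsub>Q\<^esub>"
      using powerful_quotient_agemo2[OF less.prems(1,2)] .
    interpret \<phi>: group_epi G Q \<phi> by fact
    have Qfpg: "finite_p_group p Q"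
      using Qpow by (simp add: powerful_def)
    have h: "h \<in> carrier G"
      using less.prems(3) subgroup.subset[OF agemo_subgroup] by blast
    have dist: "(q \<otimes>\<^bsub>Q\<^esub> r) [^]\<^bsub>Q\<^esub> p = q [^]\<^bsub>Q\<^esub> p \<otimes>\<^bsub>Q\<^esub> r [^]\<^bsub>Q\<^esub> p"
      if qr: "q \<in> carrier Q" "r \<in> carrier Q" for q r
    proof -
      have d: "commutator Q r q \<in> agemo p 1 Q"
        using Qpow qr \<phi>.H.powerful_iff[OF Qfpg] by blast
      then have "commutator Q r q \<in> centre Q"
        using Q(1) by blast
      then show ?thesis
        using \<phi>.H.pow_mult_class2_odd_prime[OF P(3) less.prems(1) qr _ \<phi>.H.commutator_mult[OF qr(2,1)] _ _ Q(2)[rule_format, OF d]] qr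
        by (auto simp: centre_def)
    qed
    have "\<phi> h \<in> agemo p 1 Q"
      by (rule \<phi>.image_mem_agemo) (rule less.prems(3))
    then obtain q where q: "q \<in> carrier Q" "\<phi> h = q [^]\<^bsub>Q\<^esub> p"
      using \<phi>.H.agemo_eq_powers_if_pow_mult[OF dist] by blast
    obtain g where g: "g \<in> carrier G" "\<phi> g = q"
      using \<phi>.lift_elem[OF q(1)] .
    define T where "T = adjoin_agemo p g"
    define k where "k = h \<otimes>\<^bsub>G\<^esub> inv\<^bsub>G\<^esub> (g [^]\<^bsub>G\<^esub> p)"
    have T: "subgroup T G" "agemo p 1 G \<subseteq> T" "g \<in> T"
      using adjoin_agemo_subgroup[OF g(1)] mem_adjoin_agemo by (auto simp: T_def)
    have "\<phi> k = \<one>\<^bsub>Q\<^esub>"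
      using h g q by (simp add: k_def \<phi>.hom_nat_pow)
    then have "k \<in> agemo2 p G"
      using \<phi>.mem_kernel_iff[of k] h g ker by (simp add: k_def)
    then have k: "k \<in> agemo p 1 (G\<lparr>carrier := T\<rparr>)"
      using agemo2_subset_agemo_restrict[OF T(1,2)] by blast
    have "g [^]\<^bsub>G\<^esub> p \<in> agemo p 1 (G\<lparr>carrier := T\<rparr>)"
      using group.pow_mem_agemo[OF subgroup_imp_group[OF T(1)], of g p] T(3)
      by (simp add: nat_pow_consistent[symmetric])
    then have "k \<otimes>\<^bsub>G\<^esub> g [^]\<^bsub>G\<^esub> p \<in> agemo p 1 (G\<lparr>carrier := T\<rparr>)"
      using subgroup.m_closed[OF group.agemo_subgroup[OF subgroup_imp_group[OF T(1)]] k] by simp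
    moreover have "k \<otimes>\<^bsub>G\<^esub> g [^]\<^bsub>G\<^esub> p = h"
      using h g by (simp add: k_def m_assoc)
    ultimately have hT: "h \<in> agemo p 1 (G\<lparr>carrier := T\<rparr>)"
      by simp
    have "\<exists>u\<in>carrier (G\<lparr>carrier := T\<rparr>). h = u [^]\<^bsub>G\<lparr>carrier := T\<rparr>\<^esub> p"
    proof (rule less.hyps[OF _ less.prems(1) _ hT])
      show "order (G\<lparr>carrier := T\<rparr>) < order G"
        using adjoin_agemo_proper[OF fpg g(1) ab] by (simp add: T_def order_def)
      show "powerful p (G\<lparr>carrier := T\<rparr>)"
        using powerful_adjoin_agemo[OF less.prems(1,2) g(1)] by (simp add: T_def)
    qed
    then show ?thesis
      using subgroup.mem_carrier[OF T(1)] by (auto simp: nat_pow_consistent[symmetric])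
  qed
qed

lemma agemo2_eq_powers:
  fixes G :: "nat monoid"
  assumes "odd p" "powerful p G" "h \<in> agemo2 p G"
  shows "\<exists>u\<in>carrier G. h = (u [^]\<^bsub>G\<^esub> p) [^]\<^bsub>G\<^esub> p"
proof -
  interpret group G
    using assms(2) by (simp add: powerful_def finite_p_group_def)
  obtain v where "v \<in> agemo p 1 G" "h = v [^]\<^bsub>G\<^esub> p"
    using agemo_eq_powers[OF assms(1) powerful_agemo[OF assms(1,2)]] assms(3)
    by (auto simp: agemo2_def nat_pow_consistent[symmetric])
  then show ?thesis
    using agemo_eq_powers[OF assms(1,2)] by blast
qed

section \<open>Elements of small order in powerful groups\<close>

definition omega_closed :: "nat \<Rightarrow> nat \<Rightarrow> ('a, 'b) monoid_scheme \<Rightarrow> bool" where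
  "omega_closed p k G \<longleftrightarrow> (\<forall>x\<in>carrier G. \<forall>y\<in>carrier G.
     x [^]\<^bsub>G\<^esub> (p ^ k) = \<one>\<^bsub>G\<^esub> \<longrightarrow> y [^]\<^bsub>G\<^esub> (p ^ k) = \<one>\<^bsub>G\<^esub> \<longrightarrow>
     (x \<otimes>\<^bsub>G\<^esub> y) [^]\<^bsub>G\<^esub> (p ^ k) = \<one>\<^bsub>G\<^esub>)"

text \<open>A fragment of regularity.  It can fail for \<open>v\<close> of larger order: \<open>v\<close> may act on an abelian normal
  subgroup in such a way that \<open>p - 1\<close> successive commutators of \<open>e\<close> with \<open>v\<close> do not vanish, and then
  \<open>(e v)^p\<close> and \<open>v^p\<close> differ by the last of them.\<close>

definition absorbing :: "nat \<Rightarrow> ('a, 'b) monoid_scheme \<Rightarrow> bool" where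
  "absorbing p G \<longleftrightarrow> (\<forall>e\<in>agemo p 1 G. \<forall>v\<in>carrier G.
     e [^]\<^bsub>G\<^esub> p = \<one>\<^bsub>G\<^esub> \<longrightarrow> (v [^]\<^bsub>G\<^esub> p) [^]\<^bsub>G\<^esub> p = \<one>\<^bsub>G\<^esub> \<longrightarrow>
     (e \<otimes>\<^bsub>G\<^esub> v) [^]\<^bsub>G\<^esub> p = v [^]\<^bsub>G\<^esub> p)"

lemma absorbingD:
  assumes "absorbing p G" "e \<in> agemo p 1 G" "v \<in> carrier G"
    "e [^]\<^bsub>G\<^esub> p = \<one>\<^bsub>G\<^esub>" "(v [^]\<^bsub>G\<^esub> p) [^]\<^bsub>G\<^esub> p = \<one>\<^bsub>G\<^esub>"
  shows "(e \<otimes>\<^bsub>G\<^esub> v) [^]\<^bsub>G\<^esub> p = v [^]\<^bsub>G\<^esub> p"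
  using assms by (simp add: absorbing_def)

context group
begin

lemma omega_closed_restrict_iff:
  assumes "subgroup H G"
  shows "omega_closed p k (G\<lparr>carrier := H\<rparr>) \<longleftrightarrow>
    (\<forall>x\<in>H. \<forall>y\<in>H. x [^] (p ^ k) = \<one> \<longrightarrow> y [^] (p ^ k) = \<one> \<longrightarrow> (x \<otimes> y) [^] (p ^ k) = \<one>)"
  by (simp add: omega_closed_def nat_pow_consistent[symmetric])

lemma omega_closed_subgroup:
  assumes "omega_closed p k G"
  shows "subgroup {x \<in> carrier G. x [^] (p ^ k) = \<one>} G"
proof (rule subgroupI)
  show "{x \<in> carrier G. x [^] (p ^ k) = \<one>} \<noteq> {}"
    by (auto intro: exI[of _ \<one>])
qed (use assms in \<open>auto simp: omega_closed_def nat_pow_inv\<close>)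

lemma omega_closed_normal:
  assumes "omega_closed p k G"
  shows "{x \<in> carrier G. x [^] (p ^ k) = \<one>} \<lhd> G"
  unfolding normal_inv_iff using omega_closed_subgroup[OF assms] by (auto simp: conj_pow)

lemma omega_closed_restrict_normal:
  assumes "H \<lhd> G" "omega_closed p k (G\<lparr>carrier := H\<rparr>)"
  shows "{x \<in> H. x [^] (p ^ k) = \<one>} \<lhd> G"
proof -
  interpret H: normal H G by fact
  interpret H': group "G\<lparr>carrier := H\<rparr>"
    by (rule subgroup_imp_group[OF H.subgroup_axioms])
  have "subgroup {x \<in> H. x [^] (p ^ k) = \<one>} (G\<lparr>carrier := H\<rparr>)"
    using H'.omega_closed_subgroup[OF assms(2)] by (simp add: nat_pow_consistent[symmetric])
  then have "subgroup {x \<in> H. x [^] (p ^ k) = \<one>} G"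
    by (rule incl_subgroup[OF H.subgroup_axioms])
  then show ?thesis
    unfolding normal_inv_iff by (auto simp: conj_pow H.inv_op_closed2)
qed

lemma pow_power_Suc: "x \<in> carrier G \<Longrightarrow> x [^] (p ^ Suc k) = (x [^] (p ^ k)) [^] (p::nat)"
  by (simp add: nat_pow_pow mult.commute)

end

text \<open>An element of \<open>G\<close> has order dividing \<open>p^(k+1)\<close> iff its image has order dividing \<open>p^k\<close>.\<close>

lemma (in group_epi) omega_closed_lift:
  assumes ker: "kernel G Q \<phi> = {x \<in> carrier G. x [^] p = \<one>}" and Q: "omega_closed p k Q"
  shows "omega_closed p (Suc k) G"
  unfolding omega_closed_def
proof (intro ballI impI)
  have iff: "x [^] (p ^ Suc k) = \<one> \<longleftrightarrow> \<phi> x [^]\<^bsub>Q\<^esub> (p ^ k) = \<one>\<^bsub>Q\<^esub>" if "x \<in> carrier G" for x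
    unfolding G.pow_power_Suc[OF that]
    using mem_kernel_iff[of "x [^] (p ^ k)"] ker that by (simp add: hom_nat_pow)
  fix x y assume "x \<in> carrier G" "y \<in> carrier G" "x [^] (p ^ Suc k) = \<one>" "y [^] (p ^ Suc k) = \<one>"
  then show "(x \<otimes> y) [^] (p ^ Suc k) = \<one>"
    using Q by (simp add: iff omega_closed_def del: power_Suc)
qed

text \<open>The step of the induction on the order that shows closure and absorption for powerful groups.  The
  abelian case, where both are immediate, is left aside.\<close>

locale powerful_induction_step = group G for p :: nat and G :: "nat monoid" (structure) +
  assumes odd: "odd p" and powerful: "powerful p G"
    and IH: "\<And>K :: nat monoid. order K < order G \<Longrightarrow> powerful p K \<Longrightarrow> omega_closed p 1 K \<and> absorbing p K"
    and noncomm: "\<exists>a\<in>carrier G. \<exists>b\<in>carrier G. a \<otimes> b \<noteq> b \<otimes> a"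
begin

lemma fpg: "finite_p_group p G"
  using powerful by (simp add: powerful_def)

lemma prime: "Factorial_Ring.prime p" and fin: "finite (carrier G)"
  using finite_p_groupD[OF fpg] by auto

lemma agemo_carrier: "h \<in> agemo p 1 G \<Longrightarrow> h \<in> carrier G"
  by (rule subgroup.mem_carrier[OF agemo_subgroup])

lemma commutator_agemo: "a \<in> carrier G \<Longrightarrow> b \<in> carrier G \<Longrightarrow> commutator G a b \<in> agemo p 1 G"
  using powerful powerful_iff[OF fpg] by blast

lemma order_adjoin_less:
  assumes "x \<in> carrier G"
  shows "order (G\<lparr>carrier := adjoin_agemo p x\<rparr>) < order G"
  using noncomm adjoin_agemo_proper[OF fpg assms] by (auto simp: order_def)

lemma order_agemo_less: "order (G\<lparr>carrier := agemo p 1 G\<rparr>) < order G"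
proof -
  have "card (agemo p 1 G) \<le> card (adjoin_agemo p \<one>)"
    using finite_subset[OF subgroup.subset[OF adjoin_agemo_subgroup[OF one_closed]] fin]
    by (rule card_mono) (rule mem_adjoin_agemo(2))
  then show ?thesis
    using order_adjoin_less[of \<one>] by (simp add: order_def)
qed

lemma agemo_omega: "omega_closed p 1 (G\<lparr>carrier := agemo p 1 G\<rparr>)"
  and agemo_absorbing: "absorbing p (G\<lparr>carrier := agemo p 1 G\<rparr>)"
  using IH[OF order_agemo_less powerful_agemo[OF odd powerful]] by auto

lemma adjoin_omega1:
  assumes "x \<in> carrier G"
  shows "omega_closed p 1 (G\<lparr>carrier := adjoin_agemo p x\<rparr>)"
  using IH[OF order_adjoin_less[OF assms] powerful_adjoin_agemo[OF odd powerful assms]] by auto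

text \<open>The quotient of this subgroup by its elements of order dividing \<open>p\<close> is again a powerful group
  smaller than \<open>G\<close>, and closure lifts from it.\<close>

lemma adjoin_omega2:
  assumes "x \<in> carrier G"
  shows "omega_closed p 2 (G\<lparr>carrier := adjoin_agemo p x\<rparr>)"
proof -
  define T where "T = G\<lparr>carrier := adjoin_agemo p x\<rparr>"
  have T: "powerful p T" "omega_closed p 1 T" "order T < order G"
    using adjoin_omega1[OF assms] powerful_adjoin_agemo[OF odd powerful assms]
      order_adjoin_less[OF assms] by (simp_all add: T_def)
  interpret T: group T
    using T(1) by (simp add: powerful_def finite_p_group_def)
  have finT: "finite (carrier T)"
    using T(1) by (simp add: powerful_def finite_p_group_def)
  obtain Q :: "nat monoid" and \<phi> where epi: "group_epi T Q \<phi>"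
    and ker: "kernel T Q \<phi> = {x \<in> carrier T. x [^]\<^bsub>T\<^esub> p ^ 1 = \<one>\<^bsub>T\<^esub>}"
    using T.quotient_on_nat[OF finT T.omega_closed_normal[OF T(2)]] .
  interpret \<phi>: group_epi T Q \<phi> by fact
  have "omega_closed p 1 Q"
    using IH[of Q] \<phi>.order_image_le[OF finT] T(3) \<phi>.powerful_image[OF T(1)] by auto
  then have "omega_closed p (Suc 1) T"
    using \<phi>.omega_closed_lift[of p 1] ker by simp
  then show ?thesis
    by (simp add: T_def numeral_2_eq_2)
qed

text \<open>The commutator is the product of \<open>x\<close> and a conjugate of \<open>inv x\<close>, and the smaller powerful group
  generated by \<open>x\<close> and the \<open>p\<close>-th powers contains both.\<close>

lemma commutator_order:
  assumes "x \<in> carrier G" "u \<in> carrier G" "x [^] (p ^ k) = \<one>"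
    and "omega_closed p k (G\<lparr>carrier := adjoin_agemo p x\<rparr>)"
  shows "commutator G x u [^] (p ^ k) = \<one>"
proof -
  note T = adjoin_agemo_subgroup[OF assms(1), of p]
  define y where "y = u \<otimes> inv x \<otimes> inv u"
  have "inv x \<in> adjoin_agemo p x"
    using subgroup.m_inv_closed[OF T mem_adjoin_agemo(1)] .
  have "u \<otimes> x \<otimes> inv u \<in> adjoin_agemo p x"
    using conj_mem_adjoin_agemo[OF powerful assms(1,2)] .
  then have "inv (u \<otimes> x \<otimes> inv u) \<in> adjoin_agemo p x"
    by (rule subgroup.m_inv_closed[OF T])
  then have y: "y \<in> adjoin_agemo p x"
    using assms(1,2) by (simp add: y_def inv_mult_group m_assoc)
  have "y [^] (p ^ k) = \<one>"
    using assms(1-3) by (simp add: y_def conj_pow nat_pow_inv)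
  then have "(x \<otimes> y) [^] (p ^ k) = \<one>"
    using assms(3,4) y mem_adjoin_agemo(1) omega_closed_restrict_iff[OF T] by blast
  then show ?thesis
    using assms(1,2) by (simp add: y_def commutator_def m_assoc)
qed

text \<open>Let \<open>F\<close> consist of the elements of order dividing \<open>p\<close> in \<open>H = agemo p 1 G\<close>.  In \<open>G/F\<close> the orders of
  \<open>e\<close> and \<open>v\<close> have dropped by a factor \<open>p\<close>, so absorption there shows that \<open>(e v)^p = f v^p\<close> with \<open>f\<close> in
  \<open>F\<close>.  On the other hand \<open>f\<close> lies in \<open>agemo2 p G\<close>, so absorption in \<open>H\<close>, applied to \<open>f\<close> and \<open>v^p\<close>,
  removes it from \<open>(f v^p)^p\<close>.\<close>

lemma absorbing2:
  assumes e: "e \<in> agemo p 1 G" and v: "v \<in> carrier G"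
    and e_ord: "(e [^] p) [^] p = \<one>" and v_ord: "((v [^] p) [^] p) [^] p = \<one>"
  shows "((e \<otimes> v) [^] p) [^] p = (v [^] p) [^] p"
proof -
  define H where "H = agemo p 1 G"
  have H: "subgroup H G" "H \<lhd> G"
    using agemo_subgroup agemo_normal by (simp_all add: H_def)
  define F where "F = {x \<in> H. x [^] p ^ 1 = \<one>}"
  have F: "F \<lhd> G"
    unfolding F_def H_def by (rule omega_closed_restrict_normal[OF agemo_normal agemo_omega])
  have eG: "e \<in> carrier G"
    using e by (rule agemo_carrier)
  have ep: "e [^] p \<in> F" and vp: "v [^] p \<in> H" "(v [^] p) [^] p \<in> F"
    using e eG v e_ord v_ord pow_mem_agemo by (simp_all add: F_def H_def)
  \<comment> \<open>If \<open>F\<close> is trivial, the quotient is not smaller, but then \<open>e\<close> itself is trivial.\<close>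
  show ?thesis
  proof (cases "\<forall>z\<in>F. z = \<one>")
    case True
    then have "e [^] p = \<one>"
      using ep by blast
    then have "e \<in> F"
      using e by (simp add: F_def H_def)
    then have "e = \<one>"
      using True by blast
    then show ?thesis
      using v by simp
  next
    case False
    then obtain z where z: "z \<in> F" "z \<noteq> \<one>"
      by blast
    obtain Q :: "nat monoid" and \<phi> where epi: "group_epi G Q \<phi>" and ker: "kernel G Q \<phi> = F"
      using quotient_on_nat[OF fin F] .
    interpret \<phi>: group_epi G Q \<phi> by fact
    have "absorbing p Q"
      using IH[of Q] \<phi>.order_image_less[OF fin _ z(2)] z(1) ker \<phi>.powerful_image[OF powerful] by simp
    moreover have "\<phi> e [^]\<^bsub>Q\<^esub> p = \<one>\<^bsub>Q\<^esub>" "(\<phi> v [^]\<^bsub>Q\<^esub> p) [^]\<^bsub>Q\<^esub> p = \<one>\<^bsub>Q\<^esub>"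
      using ep vp(2) eG v \<phi>.mem_kernel_iff[of "e [^] p"] \<phi>.mem_kernel_iff[of "(v [^] p) [^] p"] ker
      by (simp_all add: \<phi>.hom_nat_pow)
    ultimately have im: "(\<phi> e \<otimes>\<^bsub>Q\<^esub> \<phi> v) [^]\<^bsub>Q\<^esub> p = \<phi> v [^]\<^bsub>Q\<^esub> p"
      using absorbingD[OF _ \<phi>.image_mem_agemo[OF e]] v by simp
    define f where "f = (e \<otimes> v) [^] p \<otimes> inv (v [^] p)"
    have fG: "f \<in> carrier G"
      using eG v by (simp add: f_def)
    have "\<phi> f = \<one>\<^bsub>Q\<^esub>"
      using eG v im by (simp add: f_def \<phi>.hom_nat_pow)
    then have "f \<in> F"
      using \<phi>.mem_kernel_iff[OF fG] ker by simp
    then have f: "f \<in> H" "f [^] p = \<one>"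
      by (simp_all add: F_def)
    have f2: "f \<in> agemo p 1 (G\<lparr>carrier := H\<rparr>)"
      using pow_mult_mod_agemo2[OF odd powerful e v] by (simp add: f_def agemo2_def H_def)
    have "(f \<otimes> v [^] p) [^] p = (v [^] p) [^] p"
      using absorbingD[OF agemo_absorbing[folded H_def] f2, of "v [^] p"] f(2) vp(1) v_ord
      by (simp add: nat_pow_consistent[symmetric])
    moreover have "f \<otimes> v [^] p = (e \<otimes> v) [^] p"
      using eG v by (simp add: f_def m_assoc)
    ultimately show ?thesis
      by simp
  qed
qed

text \<open>Write \<open>c\<close> as \<open>u^(p^2)\<close>.  Conjugation by \<open>x\<close> multiplies \<open>u\<close> by the commutator \<open>[x, u]\<close>, whose order
  divides \<open>p^2\<close>, and by \<open>absorbing2\<close> this does not change the \<open>p^2\<close>-th power.\<close>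

lemma agemo2_order_p_commutes:
  assumes c: "c \<in> agemo2 p G" "c [^] p = \<one>" and x: "x \<in> carrier G" "x [^] (p ^ 2) = \<one>"
  shows "x \<otimes> c = c \<otimes> x"
proof -
  obtain u where u: "u \<in> carrier G" "c = (u [^] p) [^] p"
    using agemo2_eq_powers[OF odd powerful c(1)] by blast
  define e where "e = commutator G x u"
  have e: "e \<in> agemo p 1 G" "(e [^] p) [^] p = \<one>"
    using commutator_order[OF x(1) u(1) x(2) adjoin_omega2[OF x(1)]] x(1) u(1)
    by (simp_all add: e_def commutator_agemo nat_pow_pow power2_eq_square del: One_nat_def)
  have "((e \<otimes> u) [^] p) [^] p = (u [^] p) [^] p"
    by (rule absorbing2) (use e u c in auto)
  then have "x \<otimes> c \<otimes> inv x = c"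
    using x(1) u by (simp add: e_def commutator_mult_right conj_pow)
  then show ?thesis
    using x(1) u by (intro commute_if_conj_fixes) auto
qed

text \<open>The commutator \<open>d = [v, e]\<close> has order dividing \<open>p\<close>, being a product of elements of order dividing
  \<open>p\<close> in \<open>agemo p 1 G\<close>, and it lies in \<open>agemo2 p G\<close>.  So it commutes with \<open>e\<close> and \<open>v\<close>, whose orders
  divide \<open>p^2\<close>.\<close>

lemma absorbing: "absorbing p G"
  unfolding absorbing_def
proof (intro ballI impI)
  fix e v assume e: "e \<in> agemo p 1 G" "e [^] p = \<one>" and v: "v \<in> carrier G" "(v [^] p) [^] p = \<one>"
  have eG: "e \<in> carrier G"
    using e(1) by (rule agemo_carrier)
  define d where "d = commutator G v e"
  have dG: "d \<in> carrier G"
    using eG v by (simp add: d_def)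
  have "inv (commutator G e v) \<in> agemo2 p G"
    using commutator_agemo_mem_agemo2[OF odd powerful e(1) v(1)]
      subgroup.m_inv_closed[OF normal_imp_subgroup[OF agemo2_normal]] by blast
  moreover have "inv (commutator G e v) = d"
    using eG v by (simp add: d_def commutator_def inv_mult_group m_assoc)
  ultimately have d: "d \<in> agemo2 p G"
    by simp
  have "v \<otimes> e \<otimes> inv v \<in> agemo p 1 G"
    using normal.inv_op_closed2[OF agemo_normal v(1) e(1)] .
  moreover have "inv e \<in> agemo p 1 G"
    using subgroup.m_inv_closed[OF agemo_subgroup e(1)] .
  ultimately have "(v \<otimes> e \<otimes> inv v \<otimes> inv e) [^] p ^ 1 = \<one>"
    using agemo_omega eG v(1) e(2) omega_closed_restrict_iff[OF agemo_subgroup, of p 1 p 1]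
    by (simp add: conj_pow nat_pow_inv)
  then have dp: "d [^] p = \<one>"
    by (simp add: d_def commutator_def)
  have "(e \<otimes> v) [^] p = v [^] p"
  proof (rule pow_mult_class2_order_p[OF prime odd eG v(1) dG])
    show "v \<otimes> e = d \<otimes> (e \<otimes> v)"
      unfolding d_def by (rule commutator_mult[OF v(1) eG])
    show "d \<otimes> e = e \<otimes> d"
      using agemo2_order_p_commutes[OF d dp eG] e(2) eG
      by (simp add: power2_eq_square nat_pow_pow[symmetric])
    show "d \<otimes> v = v \<otimes> d"
      using agemo2_order_p_commutes[OF d dp v(1)] v
      by (simp add: power2_eq_square nat_pow_pow[symmetric])
  qed (rule e(2))
  then show "(e \<otimes> v) [^] p = v [^] p" .
qed

text \<open>The argument of \<open>agemo2_order_p_commutes\<close> with \<open>c = u^p\<close>, and absorption in \<open>G\<close> in place of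
  \<open>absorbing2\<close>.\<close>

lemma agemo_order_p_commutes:
  assumes c: "c \<in> agemo p 1 G" "c [^] p = \<one>" and x: "x \<in> carrier G" "x [^] p = \<one>"
  shows "x \<otimes> c = c \<otimes> x"
proof -
  obtain u where u: "u \<in> carrier G" "c = u [^] p"
    using agemo_eq_powers[OF odd powerful c(1)] by blast
  define e where "e = commutator G x u"
  have e: "e \<in> agemo p 1 G" "e [^] p = \<one>"
    using commutator_order[OF x(1) u(1) _ adjoin_omega1[OF x(1)]] x u(1)
    by (simp_all add: e_def commutator_agemo del: One_nat_def)
  have "(e \<otimes> u) [^] p = u [^] p"
    using absorbingD[OF absorbing e(1) u(1) e(2)] u c by simp
  then have "x \<otimes> c \<otimes> inv x = c"
    using x(1) u by (simp add: e_def commutator_mult_right conj_pow)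
  then show ?thesis
    using x(1) u by (intro commute_if_conj_fixes) auto
qed

text \<open>The commutator of \<open>x\<close> and \<open>y\<close> has order dividing \<open>p\<close> and is a product of \<open>p\<close>-th powers, so it
  commutes with both \<open>x\<close> and \<open>y\<close>.\<close>

lemma omega_closed: "omega_closed p 1 G"
  unfolding omega_closed_def power_one_right
proof (intro ballI impI)
  fix x y assume x: "x \<in> carrier G" "x [^] p = \<one>" and y: "y \<in> carrier G" "y [^] p = \<one>"
  define c where "c = commutator G y x"
  have c: "c \<in> agemo p 1 G" "c [^] p = \<one>"
    using commutator_order[OF y(1) x(1) _ adjoin_omega1[OF y(1)]] x y
    by (simp_all add: c_def commutator_agemo del: One_nat_def)
  have "(x \<otimes> y) [^] p = y [^] p"
  proof (rule pow_mult_class2_order_p[OF prime odd x(1) y(1) agemo_carrier[OF c(1)]])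
    show "y \<otimes> x = c \<otimes> (x \<otimes> y)"
      unfolding c_def by (rule commutator_mult[OF y(1) x(1)])
    show "c \<otimes> x = x \<otimes> c" "c \<otimes> y = y \<otimes> c"
      using agemo_order_p_commutes[OF c x] agemo_order_p_commutes[OF c y] by simp_all
  qed (rule x(2))
  then show "(x \<otimes> y) [^] p = \<one>"
    using y(2) by simp
qed

end

lemma powerful_omega_closed_absorbing:
  fixes G :: "nat monoid"
  assumes "odd p" "powerful p G"
  shows "omega_closed p 1 G \<and> absorbing p G"
  using assms(2)
proof (induction "order G" arbitrary: G rule: less_induct)
  case less
  interpret group G
    using less.prems by (simp add: powerful_def finite_p_group_def)
  show ?case
  proof (cases "\<forall>a\<in>carrier G. \<forall>b\<in>carrier G. a \<otimes>\<^bsub>G\<^esub> b = b \<otimes>\<^bsub>G\<^esub> a")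
    case True
    then have "(a \<otimes>\<^bsub>G\<^esub> b) [^]\<^bsub>G\<^esub> p = a [^]\<^bsub>G\<^esub> p \<otimes>\<^bsub>G\<^esub> b [^]\<^bsub>G\<^esub> p" if "a \<in> carrier G" "b \<in> carrier G" for a b
      using that by (simp add: pow_mult_distrib)
    then show ?thesis
      using subgroup.subset[OF agemo_subgroup, of p 1]
      by (auto simp: omega_closed_def absorbing_def subset_iff)
  next
    case False
    interpret powerful_induction_step p G
      by unfold_locales (use assms(1) less False in auto)
    show ?thesis
      using omega_closed absorbing by simp
  qed
qed

section \<open>Groups all of whose maximal subgroups are powerful\<close>

lemma (in group_epi) M1_p_group_image:
  assumes "M1_p_group p G"
  shows "M1_p_group p Q"
  unfolding M1_p_group_def
proof (intro conjI allI impI)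
  have G: "finite_p_group p G"
    using assms by (simp add: M1_p_group_def)
  then show "finite_p_group p Q"
    by (rule finite_p_group_image)
  fix K assume K: "subgroup K Q \<and> card (rcosets\<^bsub>Q\<^esub> K) = p"
  define M where "M = {g \<in> carrier G. \<phi> g \<in> K}"
  have M: "subgroup M G" "\<phi> ` M = K" "card (rcosets\<^bsub>G\<^esub> M) = p"
    using preimage_subgroup preimage_image card_rcosets_preimage[OF finite_p_groupD(2)[OF G]] K
    by (simp_all add: M_def)
  then have "powerful p (G\<lparr>carrier := M\<rparr>)"
    using assms by (simp add: M1_p_group_def)
  moreover have "group_epi (G\<lparr>carrier := M\<rparr>) (Q\<lparr>carrier := K\<rparr>) \<phi>"
    using induced_group_hom[OF M(1)] M(2) by (simp add: group_epi_def group_epi_axioms_def)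
  ultimately show "powerful p (Q\<lparr>carrier := K\<rparr>)"
    using group_epi.powerful_image by blast
qed

lemma (in group) generate_pair_normal_mult:
  assumes "N \<lhd> G" "x \<in> N" "y \<in> carrier G" "g \<in> generate G {x, y}"
  obtains n k where "n \<in> N" "g = n \<otimes> y [^] (k::int)"
proof -
  interpret N: normal N G by fact
  have "subgroup (N <#> generate G {y}) G"
    using mult_norm_subgroup[OF assms(1) generate_is_subgroup] assms(3) by simp
  moreover have "{x, y} \<subseteq> N <#> generate G {y}"
  proof -
    have "x \<otimes> \<one> \<in> N <#> generate G {y}" "\<one> \<otimes> y \<in> N <#> generate G {y}"
      unfolding set_mult_def using assms(2) N.one_closed by (blast intro: generate.intros)+
    then show ?thesis
      using assms(2,3) by simp
  qed
  ultimately have "g \<in> N <#> generate G {y}"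
    using generate_subgroup_incl assms(4) by blast
  then show thesis
    using that by (auto simp: set_mult_def generate_pow[OF assms(3)])
qed

text \<open>The elements of order dividing \<open>p\<close> in the powerful group \<open>M\<close> form a normal subgroup \<open>N\<close> of \<open>G\<close>
  containing \<open>x\<close>, so an element \<open>m\<close> of \<open>M\<close> is \<open>n y^k\<close> with \<open>n\<close> in \<open>N\<close>.  Then \<open>y^k\<close> lies in \<open>M\<close> but \<open>y\<close> does
  not, which forces \<open>y^k = 1\<close>.  Hence \<open>M\<close> has exponent dividing \<open>p\<close>, and being powerful it is abelian.\<close>

lemma maximal_subgroup_abelian:
  fixes G :: "nat monoid" and p :: nat
  assumes "odd p" and M1: "M1_p_group p G" and "x \<in> carrier G" "y \<in> carrier G"
    and xp: "x [^]\<^bsub>G\<^esub> p = \<one>\<^bsub>G\<^esub>" and yp: "y [^]\<^bsub>G\<^esub> p = \<one>\<^bsub>G\<^esub>"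
    and gen: "generate G {x, y} = carrier G"
    and M: "M \<lhd> G" "card (rcosets\<^bsub>G\<^esub> M) = p" "x \<in> M" and ab: "a \<in> M" "b \<in> M"
  shows "a \<otimes>\<^bsub>G\<^esub> b = b \<otimes>\<^bsub>G\<^esub> a"
proof -
  have G: "finite_p_group p G"
    using M1 by (simp add: M1_p_group_def)
  note P = finite_p_groupD[OF G]
  interpret group G by (rule P(1))
  interpret M: normal M G by fact
  interpret M': group "G\<lparr>carrier := M\<rparr>"
    by (rule subgroup_imp_group[OF M.subgroup_axioms])
  have pow: "powerful p (G\<lparr>carrier := M\<rparr>)"
    using M1 M M.subgroup_axioms by (simp add: M1_p_group_def)
  define N where "N = {m \<in> M. m [^]\<^bsub>G\<^esub> p ^ 1 = \<one>\<^bsub>G\<^esub>}"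
  have "omega_closed p 1 (G\<lparr>carrier := M\<rparr>)"
    using powerful_omega_closed_absorbing[OF assms(1) pow] by simp
  then have N: "N \<lhd> G"
    unfolding N_def by (rule omega_closed_restrict_normal[OF M(1)])
  have "y \<notin> M"
  proof
    assume "y \<in> M"
    then have "generate G {x, y} \<subseteq> M"
      using M(3) by (intro generate_subgroup_incl M.subgroup_axioms) auto
    then show False
      using gen M.subset proper_of_index_p[OF G M.subgroup_axioms M(2)] by blast
  qed
  have exp: "m [^]\<^bsub>G\<^esub> p = \<one>\<^bsub>G\<^esub>" if m: "m \<in> M" for m
  proof -
    have "m \<in> generate G {x, y}"
      using gen m by simp
    moreover have "x \<in> N"
      using M(3) xp by (simp add: N_def)
    ultimately obtain n and k :: int where nk: "n \<in> N" "m = n \<otimes>\<^bsub>G\<^esub> y [^]\<^bsub>G\<^esub> k"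
      using generate_pair_normal_mult[OF N _ assms(4)] by metis
    have n: "n \<in> M"
      using nk(1) by (simp add: N_def)
    have "y [^]\<^bsub>G\<^esub> k = inv\<^bsub>G\<^esub> n \<otimes>\<^bsub>G\<^esub> m"
      using nk(2) n assms(4) by (simp add: m_assoc[symmetric])
    then have yk: "y [^]\<^bsub>G\<^esub> k \<in> M"
      using n m by simp
    \<comment> \<open>Otherwise a Bezout combination recovers \<open>y\<close> from \<open>y^k\<close> and \<open>y^p = 1\<close>.\<close>
    have "int p dvd k"
    proof (rule ccontr)
      assume "\<not> int p dvd k"
      then have "coprime (int p) k"
        using P(3) by (simp add: prime_imp_coprime)
      then obtain r s where rs: "r * int p + s * k = 1"
        using bezout_int[of "int p" k] by auto
      have "y = y [^]\<^bsub>G\<^esub> (int p * r + k * s)"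
        using rs assms(4) by (simp add: mult.commute)
      also have "\<dots> = (y [^]\<^bsub>G\<^esub> int p) [^]\<^bsub>G\<^esub> r \<otimes>\<^bsub>G\<^esub> (y [^]\<^bsub>G\<^esub> k) [^]\<^bsub>G\<^esub> s"
        using assms(4) by (simp add: int_pow_mult int_pow_pow)
      also have "\<dots> = (y [^]\<^bsub>G\<^esub> k) [^]\<^bsub>G\<^esub> s"
        using yp assms(4) by (simp add: int_pow_int)
      finally show False
        using subgroup_int_pow_closed[OF M.subgroup_axioms yk, of s] \<open>y \<notin> M\<close> by simp
    qed
    then obtain j where "k = int p * j" ..
    then have "y [^]\<^bsub>G\<^esub> k = (y [^]\<^bsub>G\<^esub> int p) [^]\<^bsub>G\<^esub> j"
      using assms(4) by (simp add: int_pow_pow)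
    then have "m = n"
      using nk(2) yp n by (simp add: int_pow_int)
    then show ?thesis
      using nk(1) by (simp add: N_def)
  qed
  have "agemo p 1 (G\<lparr>carrier := M\<rparr>) \<subseteq> {\<one>\<^bsub>G\<^esub>}"
    using M'.agemo_least[OF M'.triv_subgroup, of p] exp by (simp add: nat_pow_consistent[symmetric])
  moreover have "commutator (G\<lparr>carrier := M\<rparr>) a b \<in> agemo p 1 (G\<lparr>carrier := M\<rparr>)"
    using M'.powerful_iff[OF finite_p_group_subgroup[OF G M.subgroup_axioms]] pow ab by simp
  ultimately have "commutator G a b = \<one>\<^bsub>G\<^esub>"
    using commutator_restrict[OF M.subgroup_axioms ab] by auto
  then show ?thesis
    using ab commutator_eq_one_iff[of a b] by simp
qed

text \<open>If \<open>x\<close> and \<open>y\<close> generate \<open>G\<close> and do not commute, they lie in abelian normal subgroups \<open>M\<close> and \<open>N\<close> of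
  index \<open>p\<close>.  Their commutator belongs to both, so it commutes with \<open>x\<close> and with \<open>y\<close>.\<close>

lemma M1_omega_closed_1:
  fixes G :: "nat monoid" and p :: nat
  assumes "odd p" and M1: "M1_p_group p G"
  shows "omega_closed p 1 G"
  unfolding omega_closed_def power_one_right
proof (intro ballI impI)
  fix x y assume x: "x \<in> carrier G" and y: "y \<in> carrier G"
    and xp: "x [^]\<^bsub>G\<^esub> p = \<one>\<^bsub>G\<^esub>" and yp: "y [^]\<^bsub>G\<^esub> p = \<one>\<^bsub>G\<^esub>"
  have G: "finite_p_group p G"
    using M1 by (simp add: M1_p_group_def)
  note P = finite_p_groupD[OF G]
  interpret group G by (rule P(1))
  show "(x \<otimes>\<^bsub>G\<^esub> y) [^]\<^bsub>G\<^esub> p = \<one>\<^bsub>G\<^esub>"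
  proof (cases "generate G {x, y} = carrier G")
    case False
    moreover have "subgroup (generate G {x, y}) G"
      using x y by (intro generate_is_subgroup) auto
    ultimately obtain M where M: "M \<lhd> G" "generate G {x, y} \<subseteq> M" "card (rcosets\<^bsub>G\<^esub> M) = p"
      using exists_normal_index_p[OF G] by blast
    note M' = normal_imp_subgroup[OF M(1)]
    have "omega_closed p 1 (G\<lparr>carrier := M\<rparr>)"
      using powerful_omega_closed_absorbing[OF assms(1)] M1 M(3) M' by (simp add: M1_p_group_def)
    moreover have "x \<in> M" "y \<in> M"
      using M(2) generate.incl[of _ "{x, y}" G] by auto
    ultimately show ?thesis
      using omega_closed_restrict_iff[OF M', of p 1] xp yp by simp
  next
    case gen: True
    show ?thesis
    proof (cases "x \<otimes>\<^bsub>G\<^esub> y = y \<otimes>\<^bsub>G\<^esub> x")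
      case True
      then show ?thesis
        using pow_mult_distrib[OF True x y] xp yp by simp
    next
      case noncomm: False
      have max: "\<exists>M. M \<lhd> G \<and> z \<in> M \<and> card (rcosets\<^bsub>G\<^esub> M) = p" if z: "z \<in> carrier G" for z
      proof -
        have "generate G {z} \<noteq> carrier G"
          using commute_if_generate_single[OF z _ x y] noncomm by blast
        moreover have "subgroup (generate G {z}) G"
          using z by (intro generate_is_subgroup) auto
        ultimately show ?thesis
          using exists_normal_index_p[OF G] generate.incl[of z "{z}" G] by blast
      qed
      obtain M where M: "M \<lhd> G" "card (rcosets\<^bsub>G\<^esub> M) = p" "x \<in> M"
        using max[OF x] by blast
      obtain N where N: "N \<lhd> G" "card (rcosets\<^bsub>G\<^esub> N) = p" "y \<in> N"
        using max[OF y] by blast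
      define d where "d = commutator G y x"
      have d: "d \<in> carrier G" "d \<in> M" "d \<in> N"
        using commutator_normal1[OF N(1,3) x] commutator_normal2[OF M(1) y M(3)] x y
        by (simp_all add: d_def)
      have gen': "generate G {y, x} = carrier G"
        using gen by (simp add: insert_commute)
      have "(x \<otimes>\<^bsub>G\<^esub> y) [^]\<^bsub>G\<^esub> p = y [^]\<^bsub>G\<^esub> p"
      proof (rule pow_mult_class2_order_p[OF P(3) assms(1) x y d(1)])
        show "y \<otimes>\<^bsub>G\<^esub> x = d \<otimes>\<^bsub>G\<^esub> (x \<otimes>\<^bsub>G\<^esub> y)"
          unfolding d_def by (rule commutator_mult[OF y x])
        show "d \<otimes>\<^bsub>G\<^esub> x = x \<otimes>\<^bsub>G\<^esub> d"
          by (rule maximal_subgroup_abelian[OF assms x y xp yp gen M d(2) M(3)])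
        show "d \<otimes>\<^bsub>G\<^esub> y = y \<otimes>\<^bsub>G\<^esub> d"
          by (rule maximal_subgroup_abelian[OF assms y x yp xp gen' N d(3) N(3)])
      qed (rule xp)
      then show ?thesis
        using yp by simp
    qed
  qed
qed

text \<open>Factoring out the elements of order dividing \<open>p\<close> lowers \<open>k\<close> by one.\<close>

lemma M1_omega_closed_nat:
  fixes G :: "nat monoid" and p :: nat
  assumes "odd p" "M1_p_group p G"
  shows "omega_closed p k G"
  using assms(2)
proof (induction k arbitrary: G)
  case 0
  have "finite_p_group p G"
    using 0 by (simp add: M1_p_group_def)
  then interpret group G
    by (rule finite_p_groupD)
  show ?case
    by (simp add: omega_closed_def)
next
  case (Suc k)
  have "finite_p_group p G"
    using Suc.prems by (simp add: M1_p_group_def)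
  note P = finite_p_groupD[OF this]
  interpret group G by (rule P(1))
  obtain Q :: "nat monoid" and \<phi> where epi: "group_epi G Q \<phi>"
    and ker: "kernel G Q \<phi> = {x \<in> carrier G. x [^]\<^bsub>G\<^esub> p ^ 1 = \<one>\<^bsub>G\<^esub>}"
    using quotient_on_nat[OF P(2) omega_closed_normal[OF M1_omega_closed_1[OF assms(1) Suc.prems]]] .
  interpret \<phi>: group_epi G Q \<phi> by fact
  show ?case
    using \<phi>.omega_closed_lift[of p k] ker Suc.IH[OF \<phi>.M1_p_group_image[OF Suc.prems]] by simp
qed

lemma M1_omega_closed:
  fixes p :: nat
  assumes "odd p" "M1_p_group p G"
  shows "omega_closed p k G"
proof -
  have "finite_p_group p G"
    using assms by (simp add: M1_p_group_def)
  note P = finite_p_groupD[OF this]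
  interpret group G by (rule P(1))
  obtain Q :: "nat monoid" and \<phi> where epi: "group_epi G Q \<phi>" and ker: "kernel G Q \<phi> = {\<one>\<^bsub>G\<^esub>}"
    using quotient_on_nat[OF P(2) one_is_normal] .
  interpret \<phi>: group_epi G Q \<phi> by fact
  have Q: "omega_closed p k Q"
    using M1_omega_closed_nat[OF assms(1) \<phi>.M1_p_group_image[OF assms(2)]] .
  have iff: "x [^]\<^bsub>G\<^esub> (p ^ k) = \<one>\<^bsub>G\<^esub> \<longleftrightarrow> \<phi> x [^]\<^bsub>Q\<^esub> (p ^ k) = \<one>\<^bsub>Q\<^esub>" if "x \<in> carrier G" for x
    using \<phi>.mem_kernel_iff[of "x [^]\<^bsub>G\<^esub> (p ^ k)"] that ker by (simp add: \<phi>.hom_nat_pow)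
  show ?thesis
    using Q by (simp add: omega_closed_def iff)
qed

theorem theorem4p3:
  fixes G :: "('a, 'b) monoid_scheme" and p i :: nat
  assumes "Factorial_Ring.prime p" and "odd p"
    and "M1_p_group p G"
    and "0 < i"
  shows "group_exponent (G\<lparr>carrier := Omega p i G\<rparr>) \<le> p ^ i"
proof -
  have "finite_p_group p G"
    using assms by (simp add: M1_p_group_def)
  then interpret group G
    by (rule finite_p_groupD)
  have sub: "subgroup {x \<in> carrier G. x [^]\<^bsub>G\<^esub> (p ^ i) = \<one>\<^bsub>G\<^esub>} G"
    using omega_closed_subgroup[OF M1_omega_closed[OF assms(2,3)]] .
  then have "Omega p i G \<subseteq> {x \<in> carrier G. x [^]\<^bsub>G\<^esub> (p ^ i) = \<one>\<^bsub>G\<^esub>}"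
    unfolding Omega_def by (rule generate_subgroup_incl[OF subset_refl])
  then have "\<forall>x\<in>Omega p i G. x [^]\<^bsub>G\<lparr>carrier := Omega p i G\<rparr>\<^esub> (p ^ i) = \<one>\<^bsub>G\<^esub>"
    by (auto simp: nat_pow_consistent[symmetric])
  then show ?thesis
    unfolding group_exponent_def
    using assms(1) by (intro Least_le) (simp add: prime_gt_0_nat)
qed

end
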